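(* Let $X$ be an analytic subset of a complete metric space with metric $\rho$, let $(\Lambda,\mathcal P)$ be a probability space, let $k\ge 1$ be an integer, and let $\pi:\Lambda\times X\to\mathbb R^k$ be a measurable map such that for every $\lambda\in\Lambda$ the map $\pi_\lambda:X\to\mathbb R^k$, $\pi_\lambda(x)=\pi(\lambda,x)$, is continuous. Assume that there are positive real numbers $\alpha, C$ such that $$\mathcal P\big[\lambda\in\Lambda:\ |\pi_\lambda(x_1)-\pi_\lambda(x_2)|\le \delta\, \rho(x_1,x_2)^{\alpha}\big]\le C\delta^{k}$$ for all $\delta\in(0,1)$ and all $x_1,x_2\in X$ with $x_1\ne x_2$. Suppose $HD(X)>\alpha k$, and let $X'\subset X$ be a compact subset such that $HD(X')=d>\alpha k$, $\mathcal H^d(X')>0$ and, for some constant $C'>0$, $\mathcal H^d(X'\cap B(x,\delta))\le C'\delta^d$ for all $x\in X$ and all $\delta>0$. Then: 1. For almost every $\lambda\in\Lambda$, the measure $\mu_\lambda:=(\pi_\lambda)_*(\mathcal H^d|_{X'})$ is absolutely continuous with respect to the Lebesgue measure of $\mathbb R^k$. 2. For almost every $\lambda\in\Lambda$, the Radon-Nikodym derivative $h_\lambda$ of $\mu_\lambda$ with respect to Lebesgue measure is an $L^2$ function, and $\int_\Lambda \|h_\lambda\|_{L^2}^2\,d\mathcal P(\lambda)<\infty$.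
   Context: $HD$ denotes Hausdorff dimension and $|\cdot|$ the Euclidean norm on $\mathbb R^k$. $\mathcal H^s(X)=\lim_{\epsilon\to0}\mathcal H^s_\epsilon(X)$, where $\mathcal H^s_\epsilon(X)=\inf\sum_{U\in\mathcal U}|U|^s$, the infimum being over (countable) covers $\mathcal U$ of $X$ with $\sup_{U\in\mathcal U}|U|<\epsilon$, where $|U|$ is the diameter of $U$. $B(x,\delta)$ is the open ball of center $x$ and radius $\delta$. "Almost every $\lambda$" is with respect to $\mathcal P$. *)

theory Defs
  imports "HOL-Probability.Probability_Measure"
begin

section \<open>Analytic sets\<close>

text \<open>
  The projection to the first factor of a closed subset of the product with the Baire space, where
  \<open>nat \<Rightarrow> nat\<close> carries the product of the discrete topologies. In a Polish space this is the usual
  notion (continuous image of the Baire space, or empty); in a possibly non-separable complete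
  metric space these are the Souslin sets, and they include all closed sets.
\<close>

definition analytic_set :: "'a::metric_space set \<Rightarrow> bool" where
  "analytic_set A \<longleftrightarrow> (\<exists>C :: ('a \<times> (nat \<Rightarrow> nat)) set. closed C \<and> A = fst ` C)"

lemma analytic_set_closed:
  assumes "closed A"
  shows "analytic_set A"
  unfolding analytic_set_def
  by (rule exI[of _ "A \<times> UNIV"]) (auto intro!: closed_Times assms)

lemma analytic_set_image:
  fixes f :: "(nat \<Rightarrow> nat) \<Rightarrow> 'a::metric_space"
  assumes "continuous_on UNIV f"
  shows "analytic_set (range f)"
proof -
  have "continuous_on UNIV (\<lambda>p::'a \<times> (nat \<Rightarrow> nat). f (snd p))"
    using assms by (rule continuous_on_compose2) (auto intro: continuous_on_snd continuous_on_id)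
  then have "closed {p::'a \<times> (nat \<Rightarrow> nat). fst p = f (snd p)}"
    by (intro closed_Collect_eq continuous_on_fst continuous_on_id)
  moreover have "range f = fst ` {p. fst p = f (snd p)}"
    by (auto simp: image_iff)
  ultimately show ?thesis
    unfolding analytic_set_def by blast
qed


section \<open>Hausdorff measure and Hausdorff dimension\<close>

text \<open>
  The \<open>s\<close>-th power of the diameter, with \<open>0\<^sup>0 = 1\<close> for a nonempty set and the value \<open>0\<close> for the
  empty set (whereas \<open>0 powr 0 = 0\<close>). Since \<^const>\<open>diameter\<close> is meaningful only on bounded
  sets, boundedness is required separately of the covering sets below.
\<close>

definition diam_powr :: "real \<Rightarrow> 'a::metric_space set \<Rightarrow> ennreal" where
  "diam_powr s U = (if U = {} then 0 else if s = 0 then 1 else ennreal (diameter U powr s))"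

text \<open>Countable covers are sequences of sets; finite covers are padded with empty sets.\<close>

definition fine_covers :: "real \<Rightarrow> 'a::metric_space set \<Rightarrow> (nat \<Rightarrow> 'a set) set" where
  "fine_covers \<epsilon> A =
    {U. A \<subseteq> (\<Union>i. U i) \<and> (\<forall>i. bounded (U i)) \<and> (SUP i. ennreal (diameter (U i))) < ennreal \<epsilon>}"

definition hausdorff_content :: "real \<Rightarrow> real \<Rightarrow> 'a::metric_space set \<Rightarrow> ennreal" where
  "hausdorff_content s \<epsilon> A = (INF U\<in>fine_covers \<epsilon> A. \<Sum>i. diam_powr s (U i))"

definition hausdorff_outer :: "real \<Rightarrow> 'a::metric_space set \<Rightarrow> ennreal" where
  "hausdorff_outer s A = Lim (at_right 0) (\<lambda>\<epsilon>. hausdorff_content s \<epsilon> A)"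

definition hausdorff_dim :: "'a::metric_space set \<Rightarrow> ennreal" where
  "hausdorff_dim A = Inf {ennreal s |s. 0 \<le> s \<and> hausdorff_outer s A = 0}"

text \<open>
  The restriction of the outer measure to the Borel sets; \<open>emeasure_hausdorff_measure\<close> below shows
  that the result is indeed given by \<^const>\<open>hausdorff_outer\<close>.
\<close>

definition hausdorff_measure :: "real \<Rightarrow> 'a::metric_space measure" where
  "hausdorff_measure s = measure_of UNIV (sets borel) (hausdorff_outer s)"

lemma sets_hausdorff_measure [simp]: "sets (hausdorff_measure s) = sets borel"
  unfolding hausdorff_measure_def
  by (metis sets.sets_measure_of_eq space_borel)

lemma space_hausdorff_measure [simp]: "space (hausdorff_measure s) = UNIV"
  by (metis sets_eq_imp_space_eq sets_hausdorff_measure space_borel)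

lemma hausdorff_content_antimono:
  assumes "\<epsilon> \<le> \<epsilon>'"
  shows "hausdorff_content s \<epsilon>' A \<le> hausdorff_content s \<epsilon> A"
proof -
  have "ennreal \<epsilon> \<le> ennreal \<epsilon>'"
    using assms by (rule ennreal_leI)
  then have "fine_covers \<epsilon> A \<subseteq> fine_covers \<epsilon>' A"
    unfolding fine_covers_def using order_less_le_trans by blast
  then show ?thesis
    unfolding hausdorff_content_def by (rule INF_superset_mono) simp
qed

lemma hausdorff_content_mono:
  assumes "A \<subseteq> B"
  shows "hausdorff_content s \<epsilon> A \<le> hausdorff_content s \<epsilon> B"
  unfolding hausdorff_content_def
  by (rule INF_superset_mono) (use assms in \<open>auto simp: fine_covers_def\<close>)

lemma tendsto_hausdorff_content_SUP:
  "((\<lambda>\<epsilon>. hausdorff_content s \<epsilon> A) \<longlongrightarrow> (SUP \<epsilon>\<in>{0<..}. hausdorff_content s \<epsilon> A)) (at_right 0)"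
proof (rule increasing_tendsto)
  show "\<forall>\<^sub>F \<epsilon> in at_right 0.
      hausdorff_content s \<epsilon> A \<le> (SUP \<epsilon>\<in>{0<..}. hausdorff_content s \<epsilon> A)"
    by (auto simp: eventually_at_right_field intro!: exI[of _ 1] SUP_upper)
next
  fix x assume "x < (SUP \<epsilon>\<in>{0<..}. hausdorff_content s \<epsilon> A)"
  then obtain e where "0 < e" and e: "x < hausdorff_content s e A"
    unfolding less_SUP_iff by auto
  have "x < hausdorff_content s \<epsilon> A" if "\<epsilon> < e" for \<epsilon>
    using e hausdorff_content_antimono[of \<epsilon> e s A] that by (meson less_imp_le order_less_le_trans)
  then show "\<forall>\<^sub>F \<epsilon> in at_right 0. x < hausdorff_content s \<epsilon> A"
    using \<open>0 < e\<close> by (auto simp: eventually_at_right_field)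
qed

lemma hausdorff_outer_eq_SUP: "hausdorff_outer s A = (SUP \<epsilon>\<in>{0<..}. hausdorff_content s \<epsilon> A)"
  unfolding hausdorff_outer_def
  by (rule tendsto_Lim[OF _ tendsto_hausdorff_content_SUP]) simp

lemma tendsto_hausdorff_content:
  "((\<lambda>\<epsilon>. hausdorff_content s \<epsilon> A) \<longlongrightarrow> hausdorff_outer s A) (at_right 0)"
  unfolding hausdorff_outer_eq_SUP by (rule tendsto_hausdorff_content_SUP)

lemma hausdorff_content_le_outer:
  "0 < \<epsilon> \<Longrightarrow> hausdorff_content s \<epsilon> A \<le> hausdorff_outer s A"
  unfolding hausdorff_outer_eq_SUP by (rule SUP_upper) simp

lemma hausdorff_outer_mono: "A \<subseteq> B \<Longrightarrow> hausdorff_outer s A \<le> hausdorff_outer s B"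
  unfolding hausdorff_outer_eq_SUP by (intro SUP_mono) (use hausdorff_content_mono in blast)

lemma hausdorff_outer_empty [simp]: "hausdorff_outer s {} = 0"
proof -
  have "hausdorff_content s \<epsilon> {} \<le> 0" if "0 < \<epsilon>" for \<epsilon>
    unfolding hausdorff_content_def
    by (rule INF_lower2[of "\<lambda>_. {}"]) (use that in \<open>auto simp: fine_covers_def diam_powr_def\<close>)
  then have "hausdorff_outer s {} \<le> 0"
    unfolding hausdorff_outer_eq_SUP by (intro SUP_least) auto
  then show ?thesis by simp
qed

lemma hausdorff_outer_UN_le: "hausdorff_outer s (\<Union>n. A n) \<le> (\<Sum>n. hausdorff_outer s (A n))"
proof -
  have "hausdorff_content s \<epsilon> (\<Union>n. A n) \<le> (\<Sum>n. hausdorff_outer s (A n))" if "0 < \<epsilon>" for \<epsilon>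
  proof (rule ennreal_le_epsilon)
    fix e :: real assume e: "0 < e" and fin: "(\<Sum>n. hausdorff_outer s (A n)) < top"
    have "\<exists>U\<in>fine_covers (\<epsilon>/2) (A n).
        (\<Sum>i. diam_powr s (U i)) < hausdorff_outer s (A n) + e * (1/2)^Suc n" for n
    proof -
      have "hausdorff_outer s (A n) < top"
        using fin by (auto simp: less_top dest!: ennreal_suminf_lessD)
      then have "hausdorff_outer s (A n) < hausdorff_outer s (A n) + e * (1/2)^Suc n"
        using e by (auto simp: less_top)
      moreover have "hausdorff_content s (\<epsilon>/2) (A n) \<le> hausdorff_outer s (A n)"
        using that by (intro hausdorff_content_le_outer) simp
      ultimately have "hausdorff_content s (\<epsilon>/2) (A n) < hausdorff_outer s (A n) + e * (1/2)^Suc n"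
        by (rule order.strict_trans1[rotated])
      then show ?thesis
        unfolding hausdorff_content_def INF_less_iff by blast
    qed
    then obtain B where B: "\<And>n. B n \<in> fine_covers (\<epsilon>/2) (A n)"
      and Ble: "\<And>n. (\<Sum>i. diam_powr s (B n i)) \<le> hausdorff_outer s (A n) + e * (1/2)^Suc n"
      by (metis less_imp_le)
    define C where "C = case_prod B o prod_decode"
    have bd: "bounded (C j)" and dia: "ennreal (diameter (C j)) \<le> ennreal (\<epsilon>/2)" for j
    proof -
      obtain n i where C: "C j = B n i"
        by (cases "prod_decode j") (auto simp: C_def)
      show "bounded (C j)"
        using B[of n] unfolding C fine_covers_def by auto
      have "ennreal (diameter (B n i)) \<le> (SUP i. ennreal (diameter (B n i)))"
        by (rule SUP_upper) simp
      also have "\<dots> \<le> ennreal (\<epsilon>/2)"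
        using B[of n] unfolding fine_covers_def by auto
      finally show "ennreal (diameter (C j)) \<le> ennreal (\<epsilon>/2)"
        unfolding C .
    qed
    have "(\<Union>n. A n) \<subseteq> (\<Union>j. C j)"
    proof
      fix x assume "x \<in> (\<Union>n. A n)"
      then obtain n i where "x \<in> B n i"
        using B unfolding fine_covers_def by fast
      then have "x \<in> C (prod_encode (n, i))"
        by (simp add: C_def)
      then show "x \<in> (\<Union>j. C j)" by blast
    qed
    moreover have "(SUP j. ennreal (diameter (C j))) < ennreal \<epsilon>"
    proof -
      have "(SUP j. ennreal (diameter (C j))) \<le> ennreal (\<epsilon>/2)"
        by (rule SUP_least) (rule dia)
      also have "\<dots> < ennreal \<epsilon>"
        using that by (simp add: ennreal_lessI)
      finally show ?thesis .
    qed
    ultimately have "C \<in> fine_covers \<epsilon> (\<Union>n. A n)"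
      using bd unfolding fine_covers_def by simp
    then have "hausdorff_content s \<epsilon> (\<Union>n. A n) \<le> (\<Sum>j. diam_powr s (C j))"
      unfolding hausdorff_content_def by (rule INF_lower)
    also have "\<dots> = (\<Sum>n. \<Sum>i. diam_powr s (B n i))"
      unfolding C_def comp_def by (intro suminf_ennreal_2dimen) auto
    also have "\<dots> \<le> (\<Sum>n. hausdorff_outer s (A n) + e * (1/2)^Suc n)"
      by (intro suminf_le allI Ble) auto
    also have "\<dots> = (\<Sum>n. hausdorff_outer s (A n)) + (\<Sum>n. ennreal e * ennreal ((1/2) ^ Suc n))"
      using e by (subst suminf_add[symmetric])
        (auto simp del: ennreal_suminf_cmult simp add: ennreal_mult[symmetric])
    also have "\<dots> = (\<Sum>n. hausdorff_outer s (A n)) + e"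
      unfolding ennreal_suminf_cmult
      by (subst suminf_ennreal_eq[OF zero_le_power power_half_series]) auto
    finally show "hausdorff_content s \<epsilon> (\<Union>n. A n) \<le> (\<Sum>n. hausdorff_outer s (A n)) + e" .
  qed
  then show ?thesis
    unfolding hausdorff_outer_eq_SUP[of s "\<Union>n. A n"] by (intro SUP_least) auto
qed

lemma outer_measure_space_hausdorff_outer: "outer_measure_space (Pow UNIV) (hausdorff_outer s)"
  unfolding outer_measure_space_def positive_def increasing_def countably_subadditive_def
  by (auto intro: hausdorff_outer_mono hausdorff_outer_UN_le)

lemma hausdorff_outer_Un_le:
  "hausdorff_outer s (A \<union> B) \<le> hausdorff_outer s A + hausdorff_outer s B"
  using hausdorff_outer_UN_le[of s "binaryset A B"]
  by (simp add: UN_binaryset_eq suminf_binaryset_eq)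

lemma hausdorff_outer_separated:
  assumes "0 < r" and sep: "\<And>x y. x \<in> A \<Longrightarrow> y \<in> B \<Longrightarrow> r \<le> dist x y"
  shows "hausdorff_outer s A + hausdorff_outer s B \<le> hausdorff_outer s (A \<union> B)"
proof (rule tendsto_upperbound)
  show "((\<lambda>\<epsilon>. hausdorff_content s \<epsilon> A + hausdorff_content s \<epsilon> B) \<longlongrightarrow>
      hausdorff_outer s A + hausdorff_outer s B) (at_right 0)"
    by (intro tendsto_add tendsto_hausdorff_content)
  have "hausdorff_content s \<epsilon> A + hausdorff_content s \<epsilon> B \<le> hausdorff_outer s (A \<union> B)"
    if "0 < \<epsilon>" "\<epsilon> < r" for \<epsilon>
  proof -
    have "hausdorff_content s \<epsilon> A + hausdorff_content s \<epsilon> B \<le> (\<Sum>i. diam_powr s (U i))"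
      if U: "U \<in> fine_covers \<epsilon> (A \<union> B)" for U
    proof -
      define V where "V S i = (if U i \<inter> S = {} then {} else U i)" for S i
      have "V S \<in> fine_covers \<epsilon> S" if "S \<subseteq> A \<union> B" for S
      proof -
        have "(SUP i. ennreal (diameter (V S i))) \<le> (SUP i. ennreal (diameter (U i)))"
          by (intro SUP_mono) (auto simp: V_def)
        moreover have "S \<subseteq> (\<Union>i. V S i)"
        proof
          fix x assume "x \<in> S"
          then obtain i where "x \<in> U i"
            using U \<open>S \<subseteq> A \<union> B\<close> unfolding fine_covers_def by fast
          with \<open>x \<in> S\<close> have "x \<in> V S i" by (auto simp: V_def)
          then show "x \<in> (\<Union>i. V S i)" by blast
        qed
        ultimately show ?thesis
          using U unfolding fine_covers_def by (auto simp: V_def)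
      qed
      then have "hausdorff_content s \<epsilon> A \<le> (\<Sum>i. diam_powr s (V A i))"
        "hausdorff_content s \<epsilon> B \<le> (\<Sum>i. diam_powr s (V B i))"
        unfolding hausdorff_content_def by (auto intro!: INF_lower)
      then have "hausdorff_content s \<epsilon> A + hausdorff_content s \<epsilon> B
          \<le> (\<Sum>i. diam_powr s (V A i) + diam_powr s (V B i))"
        by (subst suminf_add[symmetric]) (auto intro: add_mono)
      also have "\<dots> \<le> (\<Sum>i. diam_powr s (U i))"
      proof (intro suminf_le summableI)
        fix i
        have "U i \<inter> A = {} \<or> U i \<inter> B = {}"
        proof (rule ccontr)
          assume "\<not> ?thesis"
          then obtain x y where xy: "x \<in> U i" "x \<in> A" "y \<in> U i" "y \<in> B" by blast
          have "bounded (U i)" "ennreal (diameter (U i)) < ennreal \<epsilon>"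
            using U SUP_upper[of i UNIV "\<lambda>i. ennreal (diameter (U i))"]
            unfolding fine_covers_def by auto
          then have "dist x y < \<epsilon>"
            using diameter_bounded_bound[of "U i" x y] xy \<open>0 < \<epsilon>\<close>
            by (simp add: ennreal_less_iff diameter_ge_0)
          then show False
            using sep[of x y] xy \<open>\<epsilon> < r\<close> by simp
        qed
        then show "diam_powr s (V A i) + diam_powr s (V B i) \<le> diam_powr s (U i)"
          by (auto simp: V_def diam_powr_def)
      qed
      finally show ?thesis .
    qed
    then have "hausdorff_content s \<epsilon> A + hausdorff_content s \<epsilon> B \<le> hausdorff_content s \<epsilon> (A \<union> B)"
      unfolding hausdorff_content_def[of s \<epsilon> "A \<union> B"] by (rule INF_greatest)
    also have "\<dots> \<le> hausdorff_outer s (A \<union> B)"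
      using \<open>0 < \<epsilon>\<close> by (rule hausdorff_content_le_outer)
    finally show ?thesis .
  qed
  then show "\<forall>\<^sub>F \<epsilon> in at_right 0.
      hausdorff_content s \<epsilon> A + hausdorff_content s \<epsilon> B \<le> hausdorff_outer s (A \<union> B)"
    using \<open>0 < r\<close> by (auto simp: eventually_at_right_field)
qed simp

lemma hausdorff_outer_closed_split:
  assumes F: "closed F"
  shows "hausdorff_outer s (T \<inter> F) + hausdorff_outer s (T - F) \<le> hausdorff_outer s T"
proof (cases "F = {} \<or> hausdorff_outer s T = top")
  case True
  then show ?thesis by auto
next
  case False
  then have "F \<noteq> {}" and fin: "hausdorff_outer s T < top"
    by (auto simp: less_top)
  define B where "B n = {x\<in>T. 1 / (real n + 1) \<le> infdist x F}" for n
  define R where "R n = {x\<in>T. 1 / (real n + 2) \<le> infdist x F \<and> infdist x F < 1 / (real n + 1)}" for n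
  have lip: "infdist x F - infdist y F \<le> dist x y" for x y
    using infdist_triangle[of x F y] by (simp add: dist_commute)
  have part: "(\<Sum>i<m. hausdorff_outer s (R (2 * i + c))) \<le> hausdorff_outer s (\<Union>i<m. R (2 * i + c))"
    for m c
  proof (induction m)
    case (Suc m)
    define n where "n = 2 * m + c"
    have "(\<Sum>i<Suc m. hausdorff_outer s (R (2 * i + c)))
        \<le> hausdorff_outer s (\<Union>i<m. R (2 * i + c)) + hausdorff_outer s (R n)"
      using Suc.IH by (auto simp: n_def intro: add_mono)
    also have "\<dots> \<le> hausdorff_outer s ((\<Union>i<m. R (2 * i + c)) \<union> R n)"
    proof (cases "m = 0")
      case False
      then have n: "0 < real n" by (simp add: n_def)
      show ?thesis
      proof (rule hausdorff_outer_separated)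
        show "0 < 1 / real n - 1 / (real n + 1)"
          using n by (simp add: divide_strict_left_mono)
        fix x y assume "x \<in> (\<Union>i<m. R (2 * i + c))" and y: "y \<in> R n"
        then obtain i where "i < m" and x: "x \<in> R (2 * i + c)" by blast
        have "1 / real n \<le> 1 / (real (2 * i + c) + 2)"
          using \<open>i < m\<close> by (intro divide_left_mono) (auto simp: n_def)
        then have "1 / real n \<le> infdist x F"
          using x by (auto simp: R_def)
        moreover have "infdist y F \<le> 1 / (real n + 1)"
          using y by (auto simp: R_def)
        ultimately show "1 / real n - 1 / (real n + 1) \<le> dist x y"
          using lip[of x y] by linarith
      qed
    qed simp
    also have "(\<Union>i<m. R (2 * i + c)) \<union> R n = (\<Union>i<Suc m. R (2 * i + c))"
      by (auto simp: n_def less_Suc_eq)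
    finally show ?case .
  qed simp
  define f where "f n = hausdorff_outer s (R n)" for n
  have part': "(\<Sum>i<m. f (2 * i + c)) \<le> hausdorff_outer s T" for m c
    proof -
    have "hausdorff_outer s (\<Union>i<m. R (2 * i + c)) \<le> hausdorff_outer s T"
      by (rule hausdorff_outer_mono) (auto simp: R_def)
    then show ?thesis
      unfolding f_def by (rule order_trans[OF part])
  qed
  have "(\<Sum>i<2 * m. f i) = (\<Sum>i<m. f (2 * i + 0)) + (\<Sum>i<m. f (2 * i + 1))" for m
    by (induction m) (auto simp: algebra_simps)
  then have part2: "(\<Sum>i<2 * m. f i) \<le> hausdorff_outer s T + hausdorff_outer s T" for m
    using part' by (metis add_mono)
  have "(\<Sum>i<m. f i) \<le> hausdorff_outer s T + hausdorff_outer s T" for m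
  proof -
    have "(\<Sum>i<m. f i) \<le> (\<Sum>i<2 * m. f i)"
      by (rule sum_mono2) auto
    then show ?thesis using part2 order_trans by blast
  qed
  then have "suminf f \<le> hausdorff_outer s T + hausdorff_outer s T"
    by (intro suminf_le_const summableI)
  also have "\<dots> < top" using fin by simp
  finally have S: "suminf f < top" .
  show ?thesis
  proof (rule ennreal_le_epsilon)
    fix e :: real assume e: "0 < e"
    have "\<exists>n. suminf f < (\<Sum>i<n. f i) + e"
    proof -
      have "((\<lambda>n. (\<Sum>i<n. f i) + e) \<longlongrightarrow> suminf f + e) sequentially"
        by (intro tendsto_add summable_LIMSEQ summableI tendsto_const)
      moreover have "suminf f < suminf f + e"
        using S e by (auto simp: less_top)
      ultimately have "\<forall>\<^sub>F n in sequentially. suminf f < (\<Sum>i<n. f i) + e"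
        by (rule order_tendstoD)
      then show ?thesis
        by (auto simp: eventually_sequentially)
    qed
    then obtain n where n: "suminf f < (\<Sum>i<n. f i) + e" ..
    have "suminf f = (\<Sum>i<n. f i) + (\<Sum>i. f (i + n))"
      by (subst suminf_offset[of f n]) (auto simp: add.commute)
    moreover from this have "(\<Sum>i<n. f i) \<noteq> top"
      using S by (metis ennreal_add_eq_top less_irrefl)
    ultimately have tail: "(\<Sum>i. f (i + n)) \<le> e"
      using n by (simp add: ennreal_add_left_cancel_less less_imp_le)
    have "T - F \<subseteq> B n \<union> (\<Union>i. R (i + n))"
    proof
      fix x assume x: "x \<in> T - F"
      then have pos: "0 < infdist x F"
        using F \<open>F \<noteq> {}\<close> by (simp add: infdist_pos_not_in_closed)
      show "x \<in> B n \<union> (\<Union>i. R (i + n))"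
      proof (cases "x \<in> B n")
        case False
        define P where "P j \<longleftrightarrow> 1 / (real j + 1) \<le> infdist x F" for j
        obtain m where "1 / infdist x F < real m"
          using reals_Archimedean2 by blast
        then have "P m"
          using pos by (simp add: P_def field_simps)
        then have "P (LEAST j. P j)" by (rule LeastI)
        moreover have notle: "\<not> P j" if "j \<le> n" for j
        proof
          assume "P j"
          moreover have "1 / (real n + 1) \<le> 1 / (real j + 1)"
            using that by (intro divide_left_mono) auto
          ultimately show False
            using False x by (auto simp: P_def B_def)
        qed
        ultimately have "n < (LEAST j. P j)"
          using not_le by blast
        then obtain i where i: "(LEAST j. P j) = Suc (i + n)"
          by (metis add.commute less_imp_Suc_add)
        then have "\<not> P (i + n)"
          by (metis lessI not_less_Least)
        moreover have "P (Suc (i + n))"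
          using \<open>P (LEAST j. P j)\<close> i by simp
        ultimately have "x \<in> R (i + n)"
          using x by (auto simp: R_def P_def add_ac)
        then show ?thesis by blast
      qed simp
    qed
    then have "hausdorff_outer s (T - F) \<le> hausdorff_outer s (B n) + hausdorff_outer s (\<Union>i. R (i + n))"
      using hausdorff_outer_mono hausdorff_outer_Un_le order_trans by blast
    also have "hausdorff_outer s (\<Union>i. R (i + n)) \<le> (\<Sum>i. f (i + n))"
      unfolding f_def by (rule hausdorff_outer_UN_le)
    also note tail
    finally have TF: "hausdorff_outer s (T - F) \<le> hausdorff_outer s (B n) + e"
      by (simp add: add_left_mono)
    have "hausdorff_outer s (T \<inter> F) + hausdorff_outer s (B n) \<le> hausdorff_outer s (T \<inter> F \<union> B n)"
    proof (rule hausdorff_outer_separated)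
      show "0 < 1 / (real n + 1)" by simp
      fix x y assume "x \<in> T \<inter> F" and y: "y \<in> B n"
      then have "infdist y F \<le> dist y x"
        by (intro infdist_le) auto
      then show "1 / (real n + 1) \<le> dist x y"
        using y by (auto simp: B_def dist_commute)
    qed
    also have "\<dots> \<le> hausdorff_outer s T"
      by (rule hausdorff_outer_mono) (auto simp: B_def)
    finally have "hausdorff_outer s (T \<inter> F) + hausdorff_outer s (B n) + e \<le> hausdorff_outer s T + e"
      by (rule add_right_mono)
    moreover have "hausdorff_outer s (T \<inter> F) + hausdorff_outer s (T - F)
        \<le> hausdorff_outer s (T \<inter> F) + (hausdorff_outer s (B n) + e)"
      using TF by (rule add_left_mono)
    ultimately show "hausdorff_outer s (T \<inter> F) + hausdorff_outer s (T - F) \<le> hausdorff_outer s T + e"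
      by (metis add.assoc order_trans)
  qed
qed

lemma emeasure_hausdorff_measure:
  assumes "A \<in> sets borel"
  shows "emeasure (hausdorff_measure s) A = hausdorff_outer s A"
proof -
  interpret P: sigma_algebra UNIV "Pow UNIV :: 'a set set"
    by (rule sigma_algebra_Pow)
  define L :: "'a set set" where "L = lambda_system UNIV (Pow UNIV) (hausdorff_outer s)"
  have ms: "measure_space UNIV L (hausdorff_outer s)"
    unfolding L_def by (rule P.caratheodory_lemma[OF outer_measure_space_hausdorff_outer])
  then interpret L: sigma_algebra UNIV L
    by (simp add: measure_space_def)
  have "F \<in> L" if "closed F" for F
  proof -
    have "hausdorff_outer s (T \<inter> F) + hausdorff_outer s (T - F) = hausdorff_outer s T" for T
      using hausdorff_outer_closed_split[OF that, of s T]
        hausdorff_outer_Un_le[of s "T \<inter> F" "T - F"] by (simp add: Int_Diff_Un)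
    then show ?thesis
      unfolding L_def P.lambda_system_eq by simp
  qed
  then have "sets borel \<subseteq> L"
    unfolding borel_eq_closed using L.sigma_sets_subset[of "Collect closed"] by (auto simp: subset_iff)
  then have "countably_additive (sets borel) (hausdorff_outer s :: 'a set \<Rightarrow> ennreal)"
    using ms unfolding measure_space_def countably_additive_def by (metis subset_iff)
  then show ?thesis
    unfolding hausdorff_measure_def using assms sets.sigma_algebra_axioms[of borel]
    by (intro emeasure_measure_of_sigma) (auto simp: positive_def)
qed


section \<open>Projected measures\<close>

text \<open>The push-forward of the Hausdorff measure restricted to \<open>K\<close>, as a Borel measure.\<close>

definition projected_measure ::
    "real \<Rightarrow> 'a::metric_space set \<Rightarrow> ('a \<Rightarrow> 'b::euclidean_space) \<Rightarrow> 'b measure" where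
  "projected_measure d K f = distr (restrict_space (hausdorff_measure d) K) borel f"

lemma emeasure_projected_measure:
  assumes "compact K" "continuous_on K f" "B \<in> sets borel"
  shows "emeasure (projected_measure d K f) B = hausdorff_outer d (K \<inter> f -` B)"
proof -
  have K: "K \<in> sets borel"
    using assms(1) by (simp add: borel_compact)
  have f: "f \<in> borel_measurable (restrict_space borel K)"
    using assms(2) by (rule borel_measurable_continuous_on_restrict)
  have eq: "f -` B \<inter> K = K \<inter> f -` B" by blast
  have "sets (restrict_space (hausdorff_measure d) K) = sets (restrict_space borel K)"
    by (simp add: sets_restrict_space)
  then have f': "f \<in> measurable (restrict_space (hausdorff_measure d) K) borel"
    using f measurable_cong_sets by blast
  have "f -` B \<inter> K \<in> sets (restrict_space borel K)"
    using measurable_sets[OF f assms(3)] by (simp add: space_restrict_space)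
  then have "K \<inter> f -` B \<in> sets borel"
    using K by (simp add: sets_restrict_space_iff eq)
  then show ?thesis
    unfolding projected_measure_def using K assms(3) f'
    by (simp add: emeasure_distr space_restrict_space emeasure_restrict_space
        emeasure_hausdorff_measure eq)
qed

definition L2_norm_sq :: "('b::euclidean_space \<Rightarrow> ennreal) \<Rightarrow> ennreal" where
  "L2_norm_sq h = (\<integral>\<^sup>+ x. (h x)\<^sup>2 \<partial>lborel)"

end

theory Submission
  imports Defs
begin

text \<open>
  Write \<open>\<mu>\<close> for the restriction of \<open>\<H>\<^sup>d\<close> to \<open>X'\<close>, \<open>\<nu>\<^sub>\<lambda>\<close> for its image under \<open>\<pi>\<^sub>\<lambda>\<close>, and \<open>k\<close>
  for the dimension of the target. The proof is a potential-theoretic second moment argument,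
  carried out with dyadic cubes in place of balls.

  Averaging a finite Borel measure \<open>\<nu>\<close> over the dyadic cubes of side \<open>2\<^sup>-\<^sup>n\<close> gives a step function
  \<open>h\<^sub>n = dyadic_density \<nu> n\<close>. Its squared \<open>L\<^sup>2\<close> norm
  \<open>E\<^sub>n = dyadic_energy \<nu> n\<close> is \<open>2\<^sup>n\<^sup>k\<close> times the \<open>\<nu> \<times> \<nu>\<close>-mass of the pairs of points that
  share a cube. Integration against \<open>\<nu>\<close> and against \<open>h\<^sub>n\<close> agree on functions that are constant on
  these cubes, and Cauchy-Schwarz yields \<open>(\<integral>F d\<nu>)\<^sup>2 \<le> E\<^sub>n \<integral>F\<^sup>2\<close> for such \<open>F\<close>
  (\<open>dyadic_step_integral_sq_le\<close>). Three consequences follow. First, \<open>E\<^sub>n\<close> increases with \<open>n\<close>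
  (\<open>incseq_dyadic_energy\<close>). Secondly, if \<open>E = sup E\<^sub>n\<close> is finite, an approximation by open sets
  extends the inequality, with constant \<open>E\<close>, to square-integrable simple functions
  (\<open>simple_function_integral_sq_le\<close>); applied to indicators of null sets it shows that \<open>\<nu>\<close> is
  absolutely continuous. Thirdly, duality shows that the squared \<open>L\<^sup>2\<close> norm of the density is exactly
  \<open>E\<close> (\<open>L2_norm_sq_RN_deriv\<close>). This equality, and not only an upper bound, also gives the
  measurability of the squared norm in \<open>\<lambda>\<close>, since every \<open>E\<^sub>n(\<lambda>)\<close> is measurable by Fubini.

  It remains to bound the expectation of \<open>E\<^sub>n(\<lambda>)\<close> uniformly in \<open>n\<close>. Points in one cube have distance
  at most \<open>k 2\<^sup>-\<^sup>n\<close>, so by Fubini and transversality this expectation is at most a constant times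
  \<open>\<integral>\<integral> \<rho>(x,y) powr (-\<alpha>k) d\<mu>(y) d\<mu>(x)\<close>, the factors \<open>2\<^sup>n\<^sup>k\<close> and \<open>2\<^sup>-\<^sup>n\<^sup>k\<close> cancelling
  (\<open>nn_integral_dyadic_energy_distr_le\<close>). The growth condition on \<open>\<mu>\<close> and \<open>\<alpha>k < d\<close> make the inner
  integral bounded in \<open>x\<close> (\<open>nn_integral_dist_powr_le\<close>). Monotone convergence in \<open>n\<close> finishes the
  proof.
\<close>

section \<open>Dyadic cubes\<close>

definition dyadic_index :: "nat \<Rightarrow> real ^ 'k \<Rightarrow> int ^ 'k" where
  "dyadic_index n u = (\<chi> i. \<lfloor>2 ^ n * u $ i\<rfloor>)"

lemma measurable_dyadic_index [measurable]:
  "dyadic_index n \<in> borel \<rightarrow>\<^sub>M (count_space UNIV :: (int ^ 'k) measure)"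
proof (subst measurable_count_space_eq_countable)
  have "dyadic_index n -` {z} = {u :: real ^ 'k. \<forall>i. \<lfloor>2 ^ n * u $ i\<rfloor> = z $ i}" for z
    by (auto simp: dyadic_index_def vec_eq_iff)
  moreover have "{u :: real ^ 'k. \<forall>i. \<lfloor>2 ^ n * u $ i\<rfloor> = z $ i} \<in> sets borel" for z :: "int ^ 'k"
  proof -
    have [measurable]: "(\<lambda>u :: real ^ 'k. u $ i) \<in> borel_measurable borel" for i
      by (intro borel_measurable_continuous_onI continuous_on_component continuous_on_id)
    have "{u \<in> space borel. \<forall>i\<in>UNIV. \<lfloor>2 ^ n * (u :: real ^ 'k) $ i\<rfloor> = z $ i} \<in> sets borel"
      by (intro sets.sets_Collect_finite_All) (auto, measurable)
    then show ?thesis by simp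
  qed
  ultimately show "dyadic_index n \<in> space borel \<rightarrow> UNIV \<and>
      (\<forall>z\<in>UNIV. dyadic_index n -` {z :: int ^ 'k} \<inter> space borel \<in> sets borel)"
    by simp
qed (rule countableI_type)

lemma pred_dyadic_index_eq [measurable]:
  fixes f g :: "'a \<Rightarrow> real ^ 'k"
  assumes [measurable]: "f \<in> borel_measurable N" "g \<in> borel_measurable N"
  shows "Measurable.pred N (\<lambda>x. dyadic_index n (f x) = dyadic_index n (g x))"
proof -
  have "Measurable.pred N (\<lambda>x. \<exists>z. dyadic_index n (f x) = z \<and> dyadic_index n (g x) = z)"
    by measurable
  then show ?thesis by simp
qed

lemma dyadic_index_eq_imp_norm_le:
  fixes u v :: "real ^ 'k"
  assumes "dyadic_index n u = dyadic_index n v"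
  shows "norm (u - v) \<le> real CARD('k) / 2 ^ n"
proof -
  have "\<bar>(u - v) $ i\<bar> \<le> 1 / 2 ^ n" for i
  proof -
    have "\<lfloor>2 ^ n * u $ i\<rfloor> = \<lfloor>2 ^ n * v $ i\<rfloor>"
      using assms by (simp add: dyadic_index_def vec_eq_iff)
    then have "\<bar>2 ^ n * u $ i - 2 ^ n * v $ i\<bar> \<le> 1" by linarith
    then have "2 ^ n * \<bar>(u - v) $ i\<bar> \<le> 1"
      using abs_mult[of "2 ^ n" "u $ i - v $ i"] by (simp add: right_diff_distrib)
    then show ?thesis by (simp add: field_simps)
  qed
  then have "(\<Sum>i\<in>UNIV. \<bar>(u - v) $ i\<bar>) \<le> (\<Sum>i\<in>(UNIV :: 'k set). 1 / 2 ^ n)"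
    by (rule sum_mono)
  then show ?thesis
    using norm_le_l1_cart[of "u - v"] by simp
qed

lemma dyadic_index_refine:
  assumes "dyadic_index (Suc n) u = dyadic_index (Suc n) v"
  shows "dyadic_index n u = dyadic_index n v"
proof -
  have half: "\<lfloor>2 ^ n * x\<rfloor> = \<lfloor>2 ^ Suc n * x\<rfloor> div 2" for x :: real
    using floor_divide_real_eq_div[of 2 "2 ^ Suc n * x"] by simp
  show ?thesis
    using assms unfolding dyadic_index_def vec_eq_iff vec_lambda_beta half by simp
qed

text \<open>
  A dyadic cube is half-open; its volume is squeezed between those of the open and of the closed box
  with the same corners.
\<close>

lemma emeasure_dyadic_cube:
  fixes u :: "real ^ 'k"
  shows "emeasure lborel {v. dyadic_index n v = dyadic_index n u} = ennreal ((1 / 2 ^ n) ^ CARD('k))"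
proof -
  define l :: "real ^ 'k" where "l = (\<chi> i. real_of_int \<lfloor>2 ^ n * u $ i\<rfloor> / 2 ^ n)"
  define r :: "real ^ 'k" where "r = (\<chi> i. (real_of_int \<lfloor>2 ^ n * u $ i\<rfloor> + 1) / 2 ^ n)"
  let ?Q = "{v. dyadic_index n v = dyadic_index n u}"
  have Q: "v \<in> ?Q \<longleftrightarrow> (\<forall>i. l $ i \<le> v $ i \<and> v $ i < r $ i)" for v
    by (simp add: dyadic_index_def vec_eq_iff l_def r_def floor_eq_iff field_simps)
  have meas: "?Q \<in> sets lborel" by measurable
  have rl: "r - l = (\<chi> i. 1 / 2 ^ n)"
    by (simp add: vec_eq_iff l_def r_def field_simps)
  have "(\<Prod>b\<in>Basis. (r - l) \<bullet> b) = (\<Prod>b\<in>(Basis :: (real ^ 'k) set). 1 / 2 ^ n)"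
    unfolding rl by (rule prod.cong) (auto simp: Basis_vec_def inner_axis)
  then have prod: "(\<Prod>b\<in>Basis. (r - l) \<bullet> b) = (1 / 2 ^ n) ^ CARD('k)" by simp
  have le: "l \<bullet> b \<le> r \<bullet> b" if "b \<in> Basis" for b
    using that by (auto simp: Basis_vec_def inner_axis l_def r_def field_simps)
  show ?thesis
  proof (rule antisym)
    have "emeasure lborel ?Q \<le> emeasure lborel (cbox l r)"
      by (rule emeasure_mono) (auto simp only: Q mem_box_cart less_imp_le subset_iff sets_lborel closed_cbox borel_closed)
    then show "emeasure lborel ?Q \<le> ennreal ((1 / 2 ^ n) ^ CARD('k))"
      using le by (simp add: emeasure_lborel_cbox_eq prod)
    have "emeasure lborel (box l r) \<le> emeasure lborel ?Q"
      by (rule emeasure_mono) (use meas in \<open>auto simp only: Q mem_box_cart less_imp_le subset_iff\<close>)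
    then show "ennreal ((1 / 2 ^ n) ^ CARD('k)) \<le> emeasure lborel ?Q"
      using le by (simp add: emeasure_lborel_box_eq prod)
  qed
qed

lemma eventually_dyadic_cube_subset_open:
  fixes u :: "real ^ 'k"
  assumes "open U" "u \<in> U"
  shows "\<forall>\<^sub>F n in sequentially. {v. dyadic_index n v = dyadic_index n u} \<subseteq> U"
proof -
  obtain e where "0 < e" and e: "ball u e \<subseteq> U"
    using assms openE by blast
  have "(\<lambda>n. real CARD('k) * (1 / 2) ^ n) \<longlonglongrightarrow> real CARD('k) * 0"
    by (intro tendsto_mult tendsto_const LIMSEQ_power_zero) auto
  then have "\<forall>\<^sub>F n in sequentially. real CARD('k) * (1 / 2) ^ n < e"
    using \<open>0 < e\<close> by (intro order_tendstoD(2)[where y="real CARD('k) * 0"]) auto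
  then show ?thesis
  proof eventually_elim
    case (elim n)
    have "v \<in> ball u e" if "dyadic_index n v = dyadic_index n u" for v
    proof -
      have "norm (u - v) \<le> real CARD('k) * (1 / 2) ^ n"
        using dyadic_index_eq_imp_norm_le[OF that]
        by (simp add: norm_minus_commute power_one_over field_simps)
      then show ?thesis using elim by (simp add: dist_norm)
    qed
    then show ?case using e by blast
  qed
qed

section \<open>Dyadic averages of a measure\<close>

text \<open>
  The density at \<open>v\<close> of the uniform distribution on the cube of \<open>u\<close>. Being symmetric in \<open>u\<close> and \<open>v\<close>,
  it turns the identities between \<open>\<nu>\<close> and its averages into instances of Tonelli's theorem, with no
  summation over cubes.
\<close>

definition dyadic_kernel :: "nat \<Rightarrow> real ^ 'k \<Rightarrow> real ^ 'k \<Rightarrow> ennreal" where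
  "dyadic_kernel n u v = (if dyadic_index n u = dyadic_index n v then 2 ^ (n * CARD('k)) else 0)"

lemma borel_measurable_dyadic_kernel [measurable]:
  assumes [measurable]: "f \<in> borel_measurable N" "g \<in> borel_measurable N"
  shows "(\<lambda>x. dyadic_kernel n (f x) (g x)) \<in> borel_measurable N"
  unfolding dyadic_kernel_def by measurable

lemma nn_integral_dyadic_kernel:
  fixes u :: "real ^ 'k"
  shows "(\<integral>\<^sup>+ v. dyadic_kernel n u v \<partial>lborel) = 1"
proof -
  have "(\<integral>\<^sup>+ v. dyadic_kernel n u v \<partial>lborel)
      = (\<integral>\<^sup>+ v. 2 ^ (n * CARD('k)) * indicator {v. dyadic_index n v = dyadic_index n u} v \<partial>lborel)"
    by (intro nn_integral_cong) (auto simp: dyadic_kernel_def indicator_def)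
  also have "\<dots> = 2 ^ (n * CARD('k)) * ennreal ((1 / 2 ^ n) ^ CARD('k))"
    by (subst nn_integral_cmult_indicator) (auto simp: emeasure_dyadic_cube)
  also have "\<dots> = ennreal (2 ^ (n * CARD('k)) * (1 / 2 ^ n) ^ CARD('k))"
    by (simp add: ennreal_mult ennreal_power[symmetric])
  also have "\<dots> = 1"
    by (simp add: power_mult power_divide)
  finally show ?thesis .
qed

definition dyadic_density :: "(real ^ 'k) measure \<Rightarrow> nat \<Rightarrow> real ^ 'k \<Rightarrow> ennreal" where
  "dyadic_density \<nu> n v = (\<integral>\<^sup>+ u. dyadic_kernel n u v \<partial>\<nu>)"

text \<open>
  Integration is against \<open>\<nu>\<close>, not Lebesgue measure: the value is \<open>2\<^sup>n\<^sup>k\<close> times the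
  \<open>\<nu> \<times> \<nu>\<close>-measure of the pairs lying in a common cube. That it is the squared \<open>L\<^sup>2\<close> norm of the
  averaged density is \<open>nn_integral_dyadic_density_sq\<close> below.
\<close>

definition dyadic_energy :: "(real ^ 'k) measure \<Rightarrow> nat \<Rightarrow> ennreal" where
  "dyadic_energy \<nu> n = (\<integral>\<^sup>+ v. dyadic_density \<nu> n v \<partial>\<nu>)"

locale finite_borel_measure_vec = finite_measure \<nu> for \<nu> :: "(real ^ 'k) measure" +
  assumes sets_eq_borel [measurable_cong]: "sets \<nu> = sets borel"
begin

lemma borel_measurable_dyadic_density [measurable]:
  "dyadic_density \<nu> n \<in> borel_measurable borel"
  unfolding dyadic_density_def by measurable

lemma dyadic_density_cong:
  "dyadic_index n u = dyadic_index n v \<Longrightarrow> dyadic_density \<nu> n u = dyadic_density \<nu> n v"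
  by (simp add: dyadic_density_def dyadic_kernel_def)

text \<open>
  Insert the mean of the kernel, which is 1, replace \<open>F u\<close> by \<open>F v\<close> where the kernel does not vanish,
  and exchange the integrals.
\<close>

lemma nn_integral_dyadic_step:
  assumes [measurable]: "F \<in> borel_measurable borel"
    and step: "\<And>u v. dyadic_index n u = dyadic_index n v \<Longrightarrow> F u = F v"
  shows "(\<integral>\<^sup>+ u. F u \<partial>\<nu>) = (\<integral>\<^sup>+ v. F v * dyadic_density \<nu> n v \<partial>lborel)"
proof -
  interpret pair_sigma_finite lborel \<nu> ..
  have "(\<integral>\<^sup>+ u. F u \<partial>\<nu>) = (\<integral>\<^sup>+ u. F u * (\<integral>\<^sup>+ v. dyadic_kernel n u v \<partial>lborel) \<partial>\<nu>)"
    by (simp add: nn_integral_dyadic_kernel)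
  also have "\<dots> = (\<integral>\<^sup>+ u. \<integral>\<^sup>+ v. F u * dyadic_kernel n u v \<partial>lborel \<partial>\<nu>)"
    by (intro nn_integral_cong nn_integral_cmult[symmetric]) measurable
  also have "\<dots> = (\<integral>\<^sup>+ u. \<integral>\<^sup>+ v. F v * dyadic_kernel n u v \<partial>lborel \<partial>\<nu>)"
    by (intro nn_integral_cong) (auto simp: dyadic_kernel_def dest: step)
  also have "\<dots> = (\<integral>\<^sup>+ v. \<integral>\<^sup>+ u. F v * dyadic_kernel n u v \<partial>\<nu> \<partial>lborel)"
    by (rule Fubini') measurable
  also have "\<dots> = (\<integral>\<^sup>+ v. F v * dyadic_density \<nu> n v \<partial>lborel)"
    unfolding dyadic_density_def by (intro nn_integral_cong nn_integral_cmult) measurable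
  finally show ?thesis .
qed

lemma nn_integral_dyadic_density_sq:
  "(\<integral>\<^sup>+ v. (dyadic_density \<nu> n v)\<^sup>2 \<partial>lborel) = dyadic_energy \<nu> n"
  unfolding dyadic_energy_def power2_eq_square
  by (rule nn_integral_dyadic_step[symmetric]) (auto dest: dyadic_density_cong)

lemma dyadic_step_integral_sq_le:
  assumes [measurable]: "F \<in> borel_measurable borel"
    and step: "\<And>u v. dyadic_index n u = dyadic_index n v \<Longrightarrow> F u = F v"
  shows "(\<integral>\<^sup>+ u. F u \<partial>\<nu>)\<^sup>2 \<le> dyadic_energy \<nu> n * (\<integral>\<^sup>+ v. (F v)\<^sup>2 \<partial>lborel)"
  using Cauchy_Schwarz_nn_integral[of F lborel "dyadic_density \<nu> n"]
  by (simp add: nn_integral_dyadic_step[OF assms] nn_integral_dyadic_density_sq mult.commute)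

lemma dyadic_energy_finite: "dyadic_energy \<nu> n < \<infinity>"
proof -
  have "dyadic_energy \<nu> n \<le> (\<integral>\<^sup>+ v. \<integral>\<^sup>+ u. 2 ^ (n * CARD('k)) \<partial>\<nu> \<partial>\<nu>)"
    unfolding dyadic_energy_def dyadic_density_def
    by (intro nn_integral_mono) (auto simp: dyadic_kernel_def)
  also have "\<dots> < \<infinity>"
    by (simp add: ennreal_mult_less_top less_top[symmetric] power_eq_top_ennreal ennreal_mult_eq_top_iff)
  finally show ?thesis .
qed

end

section \<open>Absolute continuity and the squared norm of the density\<close>

text \<open>
  This form of cancellation turns each Cauchy-Schwarz inequality below into a bound on an energy.
\<close>

lemma ennreal_square_le_mult_imp_le:
  fixes x y :: ennreal
  assumes "x\<^sup>2 \<le> y * x" "x < \<infinity>"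
  shows "x \<le> y"
proof (cases "x = 0")
  case False
  have "x * x \<le> x * y"
    using assms(1) by (simp add: power2_eq_square mult.commute)
  then show ?thesis
    using False assms(2) by (simp add: ennreal_mult_le_mult_iff)
qed simp

lemma ennreal_square_le_imp_le_sqrt:
  assumes "x\<^sup>2 \<le> ennreal b" "0 \<le> b"
  shows "x \<le> ennreal (sqrt b)"
proof (cases x)
  case (real r)
  then show ?thesis using assms
    by (auto simp: ennreal_power real_le_rsqrt intro!: ennreal_leI)
next
  case top
  then show ?thesis using assms by (simp add: power2_eq_square top_unique)
qed

context finite_borel_measure_vec
begin

text \<open>
  The averaged density of level \<open>n\<close> is itself a step function of level \<open>n + 1\<close>. Testing the
  inequality of level \<open>n + 1\<close> on it gives \<open>E\<^sub>n\<^sup>2 \<le> E\<^sub>n\<^sub>+\<^sub>1 E\<^sub>n\<close>.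
\<close>

lemma incseq_dyadic_energy: "incseq (dyadic_energy \<nu>)"
proof (rule incseq_SucI)
  fix n
  have "(dyadic_energy \<nu> n)\<^sup>2 \<le> dyadic_energy \<nu> (Suc n) * dyadic_energy \<nu> n"
    using dyadic_step_integral_sq_le[of "dyadic_density \<nu> n" "Suc n", OF borel_measurable_dyadic_density
        dyadic_density_cong[OF dyadic_index_refine]]
    unfolding nn_integral_dyadic_density_sq dyadic_energy_def[of \<nu> n, symmetric] .
  then show "dyadic_energy \<nu> n \<le> dyadic_energy \<nu> (Suc n)"
    by (rule ennreal_square_le_mult_imp_le) (rule dyadic_energy_finite)
qed

text \<open>
  Every level set of \<open>s\<close> is enlarged to an open set, which changes the Lebesgue integral of the
  square arbitrarily little. Keeping only the cubes of level \<open>n\<close> contained in these open sets produces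
  step functions to which \<open>dyadic_step_integral_sq_le\<close> applies. Each point of an open set has a small
  cube inside it, so the inferior limit of the step functions dominates \<open>s\<close>, and Fatou's lemma
  concludes.
\<close>

lemma simple_function_integral_sq_le:
  fixes s :: "real ^ 'k \<Rightarrow> real"
  assumes s: "simple_function borel s" and nonneg: "\<And>u. 0 \<le> s u"
    and fin: "(\<integral>\<^sup>+ u. ennreal ((s u)\<^sup>2) \<partial>lborel) < \<infinity>"
    and energy: "\<And>n. dyadic_energy \<nu> n \<le> ennreal E" and "0 \<le> E"
  shows "(\<integral>\<^sup>+ u. ennreal (s u) \<partial>\<nu>)\<^sup>2 \<le> ennreal E * (\<integral>\<^sup>+ u. ennreal ((s u)\<^sup>2) \<partial>lborel)"
proof -
  define R where "R = range s"
  define c where "c = (\<Sum>y\<in>R. y\<^sup>2)"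
  have "finite R"
    using simple_functionD(1)[OF s] by (simp add: R_def)
  have "0 \<le> c" unfolding c_def by (simp add: sum_nonneg)
  have [measurable]: "s \<in> borel_measurable borel"
    using s by (rule borel_measurable_simple_function)
  have level [measurable]: "s -` {y} \<in> sets borel" for y
    using measurable_sets[of s borel borel "{y}"] by simp
  have single: "(s u)\<^sup>2 = (\<Sum>y\<in>R. y\<^sup>2 * indicat_real (s -` {y}) u)" for u
  proof -
    have "(\<Sum>y\<in>R. y\<^sup>2 * indicat_real (s -` {y}) u) = (\<Sum>y\<in>R. if y = s u then y\<^sup>2 else 0)"
      by (intro sum.cong) (auto simp: indicator_def)
    then show ?thesis using \<open>finite R\<close> by (simp add: R_def)
  qed
  have int_sum: "(\<integral>\<^sup>+ u. ennreal (\<Sum>y\<in>R. y\<^sup>2 * indicat_real (B y) u) \<partial>lborel)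
      = (\<Sum>y\<in>R. ennreal (y\<^sup>2) * emeasure lborel (B y))"
    if [measurable]: "\<And>y. B y \<in> sets borel" for B :: "real \<Rightarrow> (real ^ 'k) set"
  proof -
    have "(\<integral>\<^sup>+ u. ennreal (\<Sum>y\<in>R. y\<^sup>2 * indicat_real (B y) u) \<partial>lborel)
        = (\<integral>\<^sup>+ u. (\<Sum>y\<in>R. ennreal (y\<^sup>2) * indicator (B y) u) \<partial>lborel)"
      by (intro nn_integral_cong, subst sum_ennreal[symmetric])
        (auto intro!: sum.cong simp: ennreal_mult ennreal_indicator)
    also have "\<dots> = (\<Sum>y\<in>R. ennreal (y\<^sup>2) * emeasure lborel (B y))"
      by (subst nn_integral_sum) (auto simp: nn_integral_cmult_indicator)
    finally show ?thesis .
  qed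
  obtain I where I: "(\<integral>\<^sup>+ u. ennreal ((s u)\<^sup>2) \<partial>lborel) = ennreal I" and "0 \<le> I"
    using fin by (cases "\<integral>\<^sup>+ u. ennreal ((s u)\<^sup>2) \<partial>lborel") auto
  have approx: "(\<integral>\<^sup>+ u. ennreal (s u) \<partial>\<nu>) \<le> ennreal (sqrt (E * (I + c * \<delta>)))" if "0 < \<delta>" for \<delta>
  proof -
    have "\<exists>T. open T \<and> s -` {y} \<subseteq> T \<and> emeasure lborel (T - s -` {y}) \<le> ennreal \<delta>" for y
    proof -
      obtain T where T: "open T" "s -` {y} \<subseteq> T" "emeasure lebesgue (T - s -` {y}) < ennreal \<delta>"
      proof (rule sets_lebesgue_outer_open)
        show "s -` {y} \<in> sets lebesgue"
          using level[of y] by (intro sets_completionI_sets) simp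
      qed (use \<open>0 < \<delta>\<close> in auto)
      have "T - s -` {y} \<in> sets lborel"
        using level[of y] borel_open[OF T(1)] unfolding sets_lborel by (rule sets.Diff[rotated])
      then have "emeasure lborel (T - s -` {y}) \<le> ennreal \<delta>"
        using T(3) emeasure_completion[of "T - s -` {y}" lborel] by simp
      with T(1,2) show ?thesis by blast
    qed
    then obtain U where U: "\<And>y. open (U y)" "\<And>y. s -` {y} \<subseteq> U y"
      "\<And>y. emeasure lborel (U y - s -` {y}) \<le> ennreal \<delta>"
      by metis
    have [measurable]: "U y \<in> sets borel" for y using U(1) by simp
    have Ule: "emeasure lborel (U y) \<le> emeasure lborel (s -` {y}) + ennreal \<delta>" for y
    proof -
      have "emeasure lborel (U y) = emeasure lborel (s -` {y} \<union> (U y - s -` {y}))"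
        using U(2) by (intro arg_cong[where f="emeasure lborel"]) auto
      also have "\<dots> \<le> emeasure lborel (s -` {y}) + emeasure lborel (U y - s -` {y})"
        by (rule emeasure_subadditive) auto
      finally show ?thesis using U(3) by (meson add_left_mono order_trans)
    qed
    have Uint: "(\<Sum>y\<in>R. ennreal (y\<^sup>2) * emeasure lborel (U y)) \<le> ennreal (I + c * \<delta>)"
    proof -
      have "(\<Sum>y\<in>R. ennreal (y\<^sup>2) * emeasure lborel (U y))
          \<le> (\<Sum>y\<in>R. ennreal (y\<^sup>2) * emeasure lborel (s -` {y}) + ennreal (y\<^sup>2 * \<delta>))"
      proof (rule sum_mono)
        fix y
        show "ennreal (y\<^sup>2) * emeasure lborel (U y)
            \<le> ennreal (y\<^sup>2) * emeasure lborel (s -` {y}) + ennreal (y\<^sup>2 * \<delta>)"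
          using mult_left_mono[OF Ule[of y], of "ennreal (y\<^sup>2)"] \<open>0 < \<delta>\<close>
          by (simp add: distrib_left ennreal_mult)
      qed
      also have "\<dots> = ennreal I + ennreal (c * \<delta>)"
        using \<open>0 < \<delta>\<close> by (simp add: sum.distrib int_sum[OF level, symmetric] single[symmetric] I
            c_def sum_distrib_right sum_ennreal del: ennreal_mult)
      also have "\<dots> = ennreal (I + c * \<delta>)"
        using \<open>0 \<le> I\<close> \<open>0 \<le> c\<close> \<open>0 < \<delta>\<close> by (simp add: ennreal_plus)
      finally show ?thesis .
    qed
    \<comment> \<open>The step function of level \<open>n\<close> is the square root of \<open>G n\<close>. Once the cube of \<open>u\<close> lies in
      \<open>U (s u)\<close>, the nonnegative sum \<open>G n u\<close> contains the term \<open>(s u)\<^sup>2\<close>.\<close>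
    define V where "V n y = {u. {v. dyadic_index n v = dyadic_index n u} \<subseteq> U y}" for n y
    define G where "G n u = (\<Sum>y\<in>R. y\<^sup>2 * indicat_real (V n y) u)" for n u
    have V [measurable]: "V n y \<in> sets borel" for n y
    proof -
      have "V n y = dyadic_index n -` {z. {v. dyadic_index n v = z} \<subseteq> U y} \<inter> space borel"
        by (auto simp: V_def)
      also have "\<dots> \<in> sets borel"
        by (rule measurable_sets[OF measurable_dyadic_index]) simp
      finally show ?thesis .
    qed
    have [measurable]: "G n \<in> borel_measurable borel" for n
      unfolding G_def by measurable
    have G0: "0 \<le> G n u" for n u
      unfolding G_def by (intro sum_nonneg) auto
    have bound: "(\<integral>\<^sup>+ u. ennreal (sqrt (G n u)) \<partial>\<nu>) \<le> ennreal (sqrt (E * (I + c * \<delta>)))" for n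
    proof (rule ennreal_square_le_imp_le_sqrt)
      have "(\<integral>\<^sup>+ u. ennreal (sqrt (G n u)) \<partial>\<nu>)\<^sup>2
          \<le> dyadic_energy \<nu> n * (\<integral>\<^sup>+ v. (ennreal (sqrt (G n v)))\<^sup>2 \<partial>lborel)"
      proof (rule dyadic_step_integral_sq_le)
        show "(\<lambda>u. ennreal (sqrt (G n u))) \<in> borel_measurable borel"
          by measurable
      qed (simp add: G_def V_def indicator_def)
      also have "(\<integral>\<^sup>+ v. (ennreal (sqrt (G n v)))\<^sup>2 \<partial>lborel) = (\<integral>\<^sup>+ v. ennreal (G n v) \<partial>lborel)"
        by (simp add: ennreal_power G0)
      also have "\<dots> = (\<Sum>y\<in>R. ennreal (y\<^sup>2) * emeasure lborel (V n y))"
        unfolding G_def by (rule int_sum) (rule V)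
      also have "\<dots> \<le> (\<Sum>y\<in>R. ennreal (y\<^sup>2) * emeasure lborel (U y))"
        by (intro sum_mono mult_left_mono emeasure_mono) (auto simp: V_def)
      also note Uint
      also have "dyadic_energy \<nu> n * ennreal (I + c * \<delta>) \<le> ennreal E * ennreal (I + c * \<delta>)"
        by (intro mult_right_mono energy) auto
      also have "\<dots> = ennreal (E * (I + c * \<delta>))"
        using \<open>0 \<le> E\<close> \<open>0 \<le> I\<close> \<open>0 \<le> c\<close> \<open>0 < \<delta>\<close> by (simp add: ennreal_mult)
      finally show "(\<integral>\<^sup>+ u. ennreal (sqrt (G n u)) \<partial>\<nu>)\<^sup>2 \<le> ennreal (E * (I + c * \<delta>))"
        by (simp add: mult_left_mono)
      show "0 \<le> E * (I + c * \<delta>)"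
        using \<open>0 \<le> E\<close> \<open>0 \<le> I\<close> \<open>0 \<le> c\<close> \<open>0 < \<delta>\<close> by simp
    qed
    have "(\<integral>\<^sup>+ u. ennreal (s u) \<partial>\<nu>) \<le> (\<integral>\<^sup>+ u. liminf (\<lambda>n. ennreal (sqrt (G n u))) \<partial>\<nu>)"
    proof (intro nn_integral_mono Liminf_bounded)
      fix u
      have "\<forall>\<^sub>F n in sequentially. u \<in> V n (s u)"
        using eventually_dyadic_cube_subset_open[OF U(1), of u "s u"] U(2)[of "s u"]
        by (auto simp: V_def)
      then show "\<forall>\<^sub>F n in sequentially. ennreal (s u) \<le> ennreal (sqrt (G n u))"
      proof eventually_elim
        case (elim n)
        have "(s u)\<^sup>2 * indicat_real (V n (s u)) u \<le> G n u"
          unfolding G_def using \<open>finite R\<close>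
          by (intro member_le_sum) (auto simp: R_def)
        then show ?case
          using elim nonneg by (intro ennreal_leI real_le_rsqrt) simp
      qed
    qed
    also have "\<dots> \<le> liminf (\<lambda>n. \<integral>\<^sup>+ u. ennreal (sqrt (G n u)) \<partial>\<nu>)"
      by (rule nn_integral_liminf) measurable
    also have "\<dots> \<le> ennreal (sqrt (E * (I + c * \<delta>)))"
      using Liminf_mono[of "\<lambda>n. \<integral>\<^sup>+ u. ennreal (sqrt (G n u)) \<partial>\<nu>" "\<lambda>_. ennreal (sqrt (E * (I + c * \<delta>)))" sequentially]
        bound by (simp add: Liminf_const)
    finally show ?thesis .
  qed
  have "((\<lambda>\<delta>. ennreal (sqrt (E * (I + c * \<delta>)))) \<longlongrightarrow> ennreal (sqrt (E * (I + c * 0)))) (at_right 0)"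
    by (intro tendsto_intros)
  then have "(\<integral>\<^sup>+ u. ennreal (s u) \<partial>\<nu>) \<le> ennreal (sqrt (E * (I + c * 0)))"
    by (rule tendsto_lowerbound) (auto simp: eventually_at_right_field intro!: exI[of _ 1] approx)
  then have "(\<integral>\<^sup>+ u. ennreal (s u) \<partial>\<nu>)\<^sup>2 \<le> (ennreal (sqrt (E * I)))\<^sup>2"
    by (intro power_mono) auto
  also have "\<dots> = ennreal E * ennreal I"
    using \<open>0 \<le> E\<close> \<open>0 \<le> I\<close> by (simp add: ennreal_power ennreal_mult)
  finally show ?thesis unfolding I .
qed

lemma absolutely_continuous_lborel:
  assumes fin: "(SUP n. dyadic_energy \<nu> n) < \<infinity>"
  shows "absolutely_continuous lborel \<nu>"
proof -
  obtain E where E: "(SUP n. dyadic_energy \<nu> n) = ennreal E" "0 \<le> E"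
    using fin by (cases "SUP n. dyadic_energy \<nu> n") auto
  show ?thesis
    unfolding absolutely_continuous_def
  proof
    fix A assume A: "A \<in> null_sets (lborel :: (real ^ 'k) measure)"
    then have [measurable]: "A \<in> sets borel" by auto
    have sq: "ennreal ((indicat_real A u)\<^sup>2) = indicator A u" for u
      by (auto simp: indicator_def)
    have "(\<integral>\<^sup>+ u. ennreal (indicat_real A u) \<partial>\<nu>)\<^sup>2
        \<le> ennreal E * (\<integral>\<^sup>+ u. ennreal ((indicat_real A u)\<^sup>2) \<partial>lborel)"
      using A E by (intro simple_function_integral_sq_le)
        (auto simp: sq E(1)[symmetric] intro: SUP_upper simple_function_indicator)
    then have "(emeasure \<nu> A)\<^sup>2 \<le> 0"
      using A by (simp add: sq ennreal_indicator nn_integral_indicator sets_eq_borel null_setsD1)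
    then show "A \<in> null_sets \<nu>"
      by (auto simp: null_sets_def sets_eq_borel)
  qed
qed

text \<open>
  Let \<open>h\<close> be the density. For simple \<open>f \<le> h\<close> one has \<open>\<integral>f\<^sup>2 \<le> \<integral>f h = \<integral>f d\<nu>\<close>, so
  \<open>simple_function_integral_sq_le\<close> gives \<open>(\<integral>f d\<nu>)\<^sup>2 \<le> E \<integral>f d\<nu>\<close> and hence \<open>\<integral>f d\<nu> \<le> E\<close>. Letting \<open>f\<close> increase to \<open>h\<close> gives
  \<open>\<integral>h\<^sup>2 = \<integral>h d\<nu> \<le> E\<close>. Conversely, Cauchy-Schwarz for \<open>E\<^sub>n = \<integral>h h\<^sub>n\<close> gives \<open>E\<^sub>n\<^sup>2 \<le> (\<integral>h\<^sup>2) E\<^sub>n\<close>.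
\<close>

lemma L2_norm_sq_RN_deriv:
  assumes fin: "(SUP n. dyadic_energy \<nu> n) < \<infinity>"
  shows "L2_norm_sq (RN_deriv lborel \<nu>) = (SUP n. dyadic_energy \<nu> n)"
proof -
  define h where "h = RN_deriv lborel \<nu>"
  have [measurable]: "h \<in> borel_measurable borel" unfolding h_def by measurable
  have "density lborel h = \<nu>"
    unfolding h_def using absolutely_continuous_lborel[OF fin]
    by (intro sigma_finite_measure.density_RN_deriv)
      (auto simp: sets_eq_borel intro: lborel.sigma_finite_measure_axioms)
  then have int_h: "(\<integral>\<^sup>+ u. f u \<partial>\<nu>) = (\<integral>\<^sup>+ u. h u * f u \<partial>lborel)"
    if "f \<in> borel_measurable borel" for f
    using that nn_integral_density[of h lborel f] by simp
  obtain E where E: "(SUP n. dyadic_energy \<nu> n) = ennreal E" "0 \<le> E"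
    using fin by (cases "SUP n. dyadic_energy \<nu> n") auto
  have energy: "dyadic_energy \<nu> n \<le> ennreal E" for n
    unfolding E(1)[symmetric] by (rule SUP_upper) simp
  obtain f where f: "\<And>i. simple_function borel (f i)" "incseq f" "\<And>i u. f i u < top"
    "\<And>u. (SUP i. f i u) = h u"
    using borel_measurable_implies_simple_function_sequence'[of h borel] by (auto simp: less_top)
  have fm [measurable]: "f i \<in> borel_measurable borel" for i
    using f(1) by (rule borel_measurable_simple_function)
  have "(\<integral>\<^sup>+ u. f i u \<partial>\<nu>) \<le> ennreal E" for i
  proof (rule ennreal_square_le_mult_imp_le)
    define s where "s u = enn2real (f i u)" for u
    have s: "ennreal (s u) = f i u" for u
      unfolding s_def using f(3)[of i u] by simp
    have s2: "ennreal ((s u)\<^sup>2) = (f i u)\<^sup>2" for u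
      unfolding s[symmetric] by (rule ennreal_power[symmetric]) (simp add: s_def)
    have "finite (range (f i))"
      using simple_functionD(1)[OF f(1)[of i]] by simp
    have "Max (range (f i)) \<in> range (f i)"
      using \<open>finite (range (f i))\<close> by (intro Max_in) auto
    then have "Max (range (f i)) < top"
      using f(3) by auto
    have "(\<integral>\<^sup>+ u. f i u \<partial>\<nu>) \<le> (\<integral>\<^sup>+ u. Max (range (f i)) \<partial>\<nu>)"
      using \<open>finite (range (f i))\<close> by (intro nn_integral_mono Max_ge) auto
    also have "\<dots> < \<infinity>"
      using \<open>Max (range (f i)) < top\<close>
      by (simp add: less_top[symmetric] ennreal_mult_eq_top_iff)
    finally show fin: "(\<integral>\<^sup>+ u. f i u \<partial>\<nu>) < \<infinity>" .
    have "f i u \<le> h u" for u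
      unfolding f(4)[symmetric] by (rule SUP_upper) simp
    then have le: "(\<integral>\<^sup>+ u. (f i u)\<^sup>2 \<partial>lborel) \<le> (\<integral>\<^sup>+ u. f i u \<partial>\<nu>)"
      unfolding int_h[OF fm] power2_eq_square by (intro nn_integral_mono mult_right_mono) auto
    have "simple_function borel s"
      unfolding s_def by (rule simple_function_compose1[OF f(1)])
    then have "(\<integral>\<^sup>+ u. ennreal (s u) \<partial>\<nu>)\<^sup>2 \<le> ennreal E * (\<integral>\<^sup>+ u. ennreal ((s u)\<^sup>2) \<partial>lborel)"
    proof (rule simple_function_integral_sq_le)
      show "(\<integral>\<^sup>+ u. ennreal ((s u)\<^sup>2) \<partial>lborel) < \<infinity>"
        unfolding s2 using le fin by (rule le_less_trans)
    qed (use energy \<open>0 \<le> E\<close> in \<open>auto simp: s_def\<close>)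
    also have "\<dots> \<le> ennreal E * (\<integral>\<^sup>+ u. f i u \<partial>\<nu>)"
      unfolding s2 by (intro mult_left_mono le) auto
    finally show "(\<integral>\<^sup>+ u. f i u \<partial>\<nu>)\<^sup>2 \<le> ennreal E * (\<integral>\<^sup>+ u. f i u \<partial>\<nu>)"
      unfolding s .
  qed
  then have "(SUP i. \<integral>\<^sup>+ u. f i u \<partial>\<nu>) \<le> ennreal E"
    by (rule SUP_least)
  also have "(SUP i. \<integral>\<^sup>+ u. f i u \<partial>\<nu>) = (\<integral>\<^sup>+ u. h u \<partial>\<nu>)"
    by (subst nn_integral_monotone_convergence_SUP[symmetric]) (auto simp: f)
  finally have upper: "(\<integral>\<^sup>+ u. (h u)\<^sup>2 \<partial>lborel) \<le> (SUP n. dyadic_energy \<nu> n)"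
    by (simp add: E int_h power2_eq_square)
  have lower: "dyadic_energy \<nu> n \<le> (\<integral>\<^sup>+ u. (h u)\<^sup>2 \<partial>lborel)" for n
  proof (rule ennreal_square_le_mult_imp_le)
    have "(dyadic_energy \<nu> n)\<^sup>2 = (\<integral>\<^sup>+ u. h u * dyadic_density \<nu> n u \<partial>lborel)\<^sup>2"
      unfolding dyadic_energy_def by (simp add: int_h)
    also have "\<dots> \<le> (\<integral>\<^sup>+ u. (h u)\<^sup>2 \<partial>lborel) * dyadic_energy \<nu> n"
      unfolding nn_integral_dyadic_density_sq[symmetric] by (rule Cauchy_Schwarz_nn_integral) measurable
    finally show "(dyadic_energy \<nu> n)\<^sup>2 \<le> (\<integral>\<^sup>+ u. (h u)\<^sup>2 \<partial>lborel) * dyadic_energy \<nu> n" .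
  qed (rule dyadic_energy_finite)
  show ?thesis
    using upper lower unfolding L2_norm_sq_def h_def[symmetric]
    by (intro antisym SUP_least)
qed

end

section \<open>Energy integrals and transversality\<close>

text \<open>
  Split the space into the shells where the distance to \<open>x\<close> is about \<open>R 2\<^sup>-\<^sup>n\<close>. The growth condition
  bounds the contribution of a shell by a constant times \<open>2 powr ((s - d) * n)\<close>, a convergent
  geometric series. The point \<open>x\<close> itself contributes nothing, because \<open>0 powr - s = 0\<close>.
\<close>

lemma nn_integral_dist_powr_le:
  fixes x :: "'a::metric_space"
  assumes [measurable]: "(\<lambda>y. dist x y) \<in> borel_measurable \<mu>"
    and growth: "\<And>\<delta>. 0 < \<delta> \<Longrightarrow> emeasure \<mu> {y \<in> space \<mu>. dist x y < \<delta>} \<le> ennreal (c * \<delta> powr d)"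
    and "0 \<le> c" "0 \<le> s" "s < d" "0 < R"
    and diam: "\<And>y. y \<in> space \<mu> \<Longrightarrow> dist x y < R"
  shows "(\<integral>\<^sup>+ y. ennreal (dist x y powr - s) \<partial>\<mu>)
    \<le> ennreal (c * R powr (d - s) * 2 powr s / (1 - 2 powr (s - d)))"
proof -
  define S where "S n = {y \<in> space \<mu>. dist x y < R * (1 / 2) ^ n}" for n :: nat
  define a where "a n = (R * (1 / 2) ^ Suc n) powr - s" for n
  define q where "q = (2 :: real) powr (s - d)"
  have q: "0 < q" "q < 1"
    using \<open>s < d\<close> powr_less_cancel_iff[of 2 "s - d" 0] by (auto simp: q_def)
  have [measurable]: "S n \<in> sets \<mu>" for n
    unfolding S_def by measurable
  have shell: "ennreal (dist x y powr - s) \<le> (\<Sum>n. ennreal (a n) * indicator (S n) y)"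
    if y: "y \<in> space \<mu>" for y
  proof (cases "dist x y = 0")
    case False
    define P where "P m \<longleftrightarrow> R * (1 / 2) ^ m \<le> dist x y" for m
    \<comment> \<open>The first \<open>m\<close> with \<open>R 2\<^sup>-\<^sup>m\<close> below the distance is positive, and its predecessor is the shell.\<close>
    obtain m where "(1 / 2) ^ m < dist x y / R"
      using real_arch_pow_inv[of "dist x y / R" "1 / 2"] False \<open>0 < R\<close> by auto
    then have "P m" using \<open>0 < R\<close> by (simp add: P_def field_simps)
    then have "P (LEAST m. P m)" by (rule LeastI)
    moreover have "\<not> P 0" using diam[OF y] by (simp add: P_def)
    ultimately obtain n where n: "(LEAST m. P m) = Suc n"
      by (metis not0_implies_Suc)
    then have "\<not> P n" by (metis lessI not_less_Least)
    then have "y \<in> S n" using y by (simp add: S_def P_def)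
    have "P (Suc n)" using \<open>P (LEAST m. P m)\<close> n by simp
    then have "dist x y powr - s \<le> a n"
      unfolding a_def P_def using \<open>0 \<le> s\<close> \<open>0 < R\<close> by (intro powr_mono2') auto
    then have "ennreal (dist x y powr - s) \<le> ennreal (a n) * indicator (S n) y"
      using \<open>y \<in> S n\<close> by (simp add: ennreal_leI)
    also have "\<dots> \<le> (\<Sum>n. ennreal (a n) * indicator (S n) y)"
    proof -
      have "(\<Sum>i\<in>{n}. ennreal (a i) * indicator (S i) y) \<le> (\<Sum>n. ennreal (a n) * indicator (S n) y)"
        by (rule sum_le_suminf) auto
      then show ?thesis by (simp only: sum.insert sum.empty finite.emptyI empty_iff add_0_right not_False_eq_True)
    qed
    finally show ?thesis .
  qed simp
  have shell_mass: "a n * (c * (R * (1 / 2) ^ n) powr d) = c * R powr (d - s) * 2 powr s * q ^ n" for n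
  proof -
    have half: "(1 / 2 :: real) ^ m = 2 powr - real m" for m
      by (simp add: powr_minus powr_realpow power_one_over inverse_eq_divide)
    have "a n = R powr - s * 2 powr (s * real (Suc n))"
      unfolding a_def half using \<open>0 < R\<close> by (simp add: powr_mult powr_powr algebra_simps)
    moreover have "(R * (1 / 2) ^ n) powr d = R powr d * 2 powr (- d * real n)"
      unfolding half using \<open>0 < R\<close> by (simp add: powr_mult powr_powr algebra_simps)
    moreover have "q ^ n = 2 powr (s * real n) * 2 powr (- d * real n)"
      unfolding q_def by (simp add: powr_realpow[symmetric] powr_powr powr_add[symmetric] algebra_simps)
    moreover have "R powr (d - s) = R powr d * R powr - s"
      by (simp add: powr_add[symmetric])
    moreover have "(2 :: real) powr (s * real (Suc n)) = 2 powr s * 2 powr (s * real n)"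
      by (simp add: powr_add[symmetric] algebra_simps)
    ultimately show ?thesis by (simp only: mult_ac)
  qed
  have "(\<integral>\<^sup>+ y. ennreal (dist x y powr - s) \<partial>\<mu>) \<le> (\<integral>\<^sup>+ y. (\<Sum>n. ennreal (a n) * indicator (S n) y) \<partial>\<mu>)"
    by (intro nn_integral_mono shell)
  also have "\<dots> = (\<Sum>n. ennreal (a n) * emeasure \<mu> (S n))"
    by (subst nn_integral_suminf) (auto simp: nn_integral_cmult_indicator)
  also have "\<dots> \<le> (\<Sum>n. ennreal (c * R powr (d - s) * 2 powr s * q ^ n))"
  proof (intro suminf_le summableI)
    fix n
    have "ennreal (a n) * emeasure \<mu> (S n) \<le> ennreal (a n) * ennreal (c * (R * (1 / 2) ^ n) powr d)"
      unfolding S_def using \<open>0 < R\<close> by (intro mult_left_mono growth) auto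
    also have "\<dots> = ennreal (a n * (c * (R * (1 / 2) ^ n) powr d))"
      using \<open>0 \<le> c\<close> by (simp add: ennreal_mult a_def)
    finally show "ennreal (a n) * emeasure \<mu> (S n) \<le> ennreal (c * R powr (d - s) * 2 powr s * q ^ n)"
      unfolding shell_mass .
  qed
  also have "\<dots> = ennreal (c * R powr (d - s) * 2 powr s * (1 / (1 - q)))"
    using q \<open>0 \<le> c\<close> by (intro suminf_ennreal_eq sums_mult geometric_sums) auto
  finally show ?thesis by (simp add: q_def)
qed

text \<open>
  Transversality with \<open>\<delta> = r / dist x y powr \<alpha>\<close>; for \<open>\<delta> \<ge> 1\<close> a probability is bounded by 1, which is
  why \<open>C\<close> becomes \<open>max C 1\<close>.
\<close>

lemma emeasure_projection_close_le:
  fixes f :: "'l \<Rightarrow> 'a::metric_space \<Rightarrow> 'b::real_normed_vector"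
  assumes "prob_space M"
    and trans: "\<And>\<delta>. \<lbrakk>0 < \<delta>; \<delta> < 1\<rbrakk> \<Longrightarrow>
      measure M {l \<in> space M. norm (f l x - f l y) \<le> \<delta> * dist x y powr \<alpha>} \<le> C * \<delta> ^ m"
    and "x \<noteq> y" "0 < r"
  shows "emeasure M {l \<in> space M. norm (f l x - f l y) \<le> r}
    \<le> ennreal (max C 1 * r ^ m * dist x y powr - (\<alpha> * real m))"
proof -
  interpret prob_space M by fact
  define \<delta> where "\<delta> = r / dist x y powr \<alpha>"
  have pos: "0 < dist x y" using \<open>x \<noteq> y\<close> by simp
  have "0 < \<delta>" using pos \<open>0 < r\<close> by (simp add: \<delta>_def)
  have r: "r = \<delta> * dist x y powr \<alpha>" using pos by (simp add: \<delta>_def)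
  have "measure M {l \<in> space M. norm (f l x - f l y) \<le> r} \<le> max C 1 * \<delta> ^ m"
  proof (cases "\<delta> < 1")
    case True
    have "measure M {l \<in> space M. norm (f l x - f l y) \<le> r} \<le> C * \<delta> ^ m"
      unfolding r using \<open>0 < \<delta>\<close> True by (rule trans)
    also have "\<dots> \<le> max C 1 * \<delta> ^ m"
      using \<open>0 < \<delta>\<close> by (intro mult_right_mono) auto
    finally show ?thesis .
  next
    case False
    have "measure M {l \<in> space M. norm (f l x - f l y) \<le> r} \<le> 1 * 1"
      by simp
    also have "\<dots> \<le> max C 1 * \<delta> ^ m"
      using False by (intro mult_mono one_le_power) auto
    finally show ?thesis .
  qed
  also have "\<delta> ^ m = r ^ m * dist x y powr - (\<alpha> * real m)"
    using pos by (simp add: \<delta>_def power_divide powr_minus powr_powr[symmetric] powr_realpow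
        field_simps)
  finally show ?thesis
    unfolding emeasure_eq_measure by (intro ennreal_leI) (simp add: mult.assoc)
qed

text \<open>
  Two images in a common cube of level \<open>n\<close> are at distance at most \<open>r = k 2\<^sup>-\<^sup>n\<close>. The hypothesis for
  this \<open>r\<close> carries the factor \<open>r\<^sup>k = k\<^sup>k 2\<^sup>-\<^sup>n\<^sup>k\<close>, which absorbs the normalisation \<open>2\<^sup>n\<^sup>k\<close> of the kernel
  and leaves a bound independent of \<open>n\<close>. Its form, an integral over \<open>y\<close> for each fixed \<open>x\<close>, is
  chosen so that a bound by a function of the distance of \<open>x\<close> and \<open>y\<close> can be used without joint
  measurability of the distance, which may fail in a non-separable space.
\<close>

lemma
  fixes f :: "'l \<Rightarrow> 'a \<Rightarrow> real ^ 'k"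
  assumes "finite_measure \<mu>" "prob_space M"
    and f: "(\<lambda>(l, x). f l x) \<in> borel_measurable (M \<Otimes>\<^sub>M \<mu>)"
  shows borel_measurable_dyadic_energy_distr:
      "(\<lambda>l. dyadic_energy (distr \<mu> borel (f l)) n) \<in> borel_measurable M" (is ?meas)
    and nn_integral_dyadic_energy_distr_le:
      "(\<And>x r. \<lbrakk>x \<in> space \<mu>; 0 < r\<rbrakk> \<Longrightarrow>
          (\<integral>\<^sup>+ y. emeasure M {l \<in> space M. norm (f l x - f l y) \<le> r} \<partial>\<mu>) \<le> ennreal (B * r ^ CARD('k)))
        \<Longrightarrow> (\<integral>\<^sup>+ l. dyadic_energy (distr \<mu> borel (f l)) n \<partial>M)
          \<le> ennreal (B * real CARD('k) ^ CARD('k)) * emeasure \<mu> (space \<mu>)" (is "PROP ?bound \<Longrightarrow> ?le")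
proof -
  interpret \<mu>: finite_measure \<mu> by fact
  interpret M: prob_space M by fact
  interpret M\<mu>: pair_sigma_finite M \<mu> ..
  have f': "(\<lambda>p. f (g p) (h p)) \<in> borel_measurable N"
    if "g \<in> N \<rightarrow>\<^sub>M M" "h \<in> N \<rightarrow>\<^sub>M \<mu>" for N and g :: "'b \<Rightarrow> 'l" and h :: "'b \<Rightarrow> 'a"
    using measurable_compose[OF measurable_Pair[OF that] f] by simp
  have fl [measurable]: "f l \<in> borel_measurable \<mu>" if "l \<in> space M" for l
    using that by (intro f') auto
  have energy: "dyadic_energy (distr \<mu> borel (f l)) n
      = (\<integral>\<^sup>+ x. \<integral>\<^sup>+ y. dyadic_kernel n (f l y) (f l x) \<partial>\<mu> \<partial>\<mu>)" if l: "l \<in> space M" for l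
  proof -
    interpret distr: finite_borel_measure_vec "distr \<mu> borel (f l)"
      using \<mu>.finite_measure_distr[OF fl[OF l]]
      by (simp add: finite_borel_measure_vec_def finite_borel_measure_vec_axioms_def)
    have [measurable]: "f l \<in> borel_measurable \<mu>" using l by (rule fl)
    have "dyadic_energy (distr \<mu> borel (f l)) n
        = (\<integral>\<^sup>+ x. dyadic_density (distr \<mu> borel (f l)) n (f l x) \<partial>\<mu>)"
      unfolding dyadic_energy_def by (rule nn_integral_distr) measurable
    also have "\<dots> = (\<integral>\<^sup>+ x. \<integral>\<^sup>+ y. dyadic_kernel n (f l y) (f l x) \<partial>\<mu> \<partial>\<mu>)"
      unfolding dyadic_density_def by (intro nn_integral_cong nn_integral_distr) measurable
    finally show ?thesis .
  qed
  have [measurable]: "(\<lambda>p. f (fst (fst p)) (snd (fst p))) \<in> borel_measurable ((M \<Otimes>\<^sub>M \<mu>) \<Otimes>\<^sub>M \<mu>)"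
    "(\<lambda>p. f (fst (fst p)) (snd p)) \<in> borel_measurable ((M \<Otimes>\<^sub>M \<mu>) \<Otimes>\<^sub>M \<mu>)"
    by (intro f'; measurable)+
  have "(\<lambda>l. \<integral>\<^sup>+ x. \<integral>\<^sup>+ y. dyadic_kernel n (f l y) (f l x) \<partial>\<mu> \<partial>\<mu>) \<in> borel_measurable M"
    by (intro \<mu>.borel_measurable_nn_integral) (simp add: split_beta', measurable)
  then show ?meas
    by (subst measurable_cong[OF energy])
  show ?le if bound: "PROP ?bound"
  proof -
    have close: "(\<integral>\<^sup>+ l. \<integral>\<^sup>+ y. dyadic_kernel n (f l y) (f l x) \<partial>\<mu> \<partial>M)
        \<le> ennreal (B * real CARD('k) ^ CARD('k))" if x: "x \<in> space \<mu>" for x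
    proof -
      define r where "r = real CARD('k) / 2 ^ n"
      have "0 < r" by (simp add: r_def)
      have [measurable]: "(\<lambda>p. f (fst p) x) \<in> borel_measurable (M \<Otimes>\<^sub>M \<mu>)"
        "(\<lambda>p. f (fst p) (snd p)) \<in> borel_measurable (M \<Otimes>\<^sub>M \<mu>)"
        "(\<lambda>l. f l x) \<in> borel_measurable M"
        using x by (intro f'; measurable)+
      have [measurable]: "(\<lambda>l. f l y) \<in> borel_measurable M" if "y \<in> space \<mu>" for y
        using that by (intro f'; measurable)
      have "(\<integral>\<^sup>+ l. \<integral>\<^sup>+ y. dyadic_kernel n (f l y) (f l x) \<partial>\<mu> \<partial>M)
          = (\<integral>\<^sup>+ y. \<integral>\<^sup>+ l. dyadic_kernel n (f l y) (f l x) \<partial>M \<partial>\<mu>)"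
        by (rule M\<mu>.Fubini'[symmetric]) (simp add: split_beta')
      also have "\<dots> \<le> (\<integral>\<^sup>+ y. 2 ^ (n * CARD('k)) * emeasure M {l \<in> space M. norm (f l x - f l y) \<le> r} \<partial>\<mu>)"
      proof (rule nn_integral_mono)
        fix y assume y: "y \<in> space \<mu>"
        have close_sets: "{l \<in> space M. norm (f l x - f l y) \<le> r} \<in> sets M"
          using y by measurable
        have "(\<integral>\<^sup>+ l. dyadic_kernel n (f l y) (f l x) \<partial>M)
            \<le> (\<integral>\<^sup>+ l. 2 ^ (n * CARD('k)) * indicator {l \<in> space M. norm (f l x - f l y) \<le> r} l \<partial>M)"
        proof (rule nn_integral_mono)
          fix l assume l: "l \<in> space M"
          show "dyadic_kernel n (f l y) (f l x)
              \<le> 2 ^ (n * CARD('k)) * indicator {l \<in> space M. norm (f l x - f l y) \<le> r} l"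
          proof (cases "dyadic_index n (f l x) = dyadic_index n (f l y)")
            case True
            then have "norm (f l x - f l y) \<le> r"
              unfolding r_def by (rule dyadic_index_eq_imp_norm_le)
            then show ?thesis
              using l by (simp add: dyadic_kernel_def)
          qed (simp add: dyadic_kernel_def eq_commute)
        qed
        also have "\<dots> = 2 ^ (n * CARD('k)) * emeasure M {l \<in> space M. norm (f l x - f l y) \<le> r}"
          by (rule nn_integral_cmult_indicator) (rule close_sets)
        finally show "(\<integral>\<^sup>+ l. dyadic_kernel n (f l y) (f l x) \<partial>M)
            \<le> 2 ^ (n * CARD('k)) * emeasure M {l \<in> space M. norm (f l x - f l y) \<le> r}" .
      qed
      also have "\<dots> = 2 ^ (n * CARD('k)) * (\<integral>\<^sup>+ y. emeasure M {l \<in> space M. norm (f l x - f l y) \<le> r} \<partial>\<mu>)"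
      proof (rule nn_integral_cmult)
        have meas: "(\<lambda>y. emeasure M (Pair y -` {p \<in> space (\<mu> \<Otimes>\<^sub>M M). norm (f (snd p) x - f (snd p) (fst p)) \<le> r}))
            \<in> borel_measurable \<mu>"
        proof (rule M.measurable_emeasure_Pair)
          have [measurable]: "(\<lambda>p. f (snd p) x) \<in> borel_measurable (\<mu> \<Otimes>\<^sub>M M)"
            "(\<lambda>p. f (snd p) (fst p)) \<in> borel_measurable (\<mu> \<Otimes>\<^sub>M M)"
            using x by (intro f'; measurable)+
          show "{p \<in> space (\<mu> \<Otimes>\<^sub>M M). norm (f (snd p) x - f (snd p) (fst p)) \<le> r} \<in> sets (\<mu> \<Otimes>\<^sub>M M)"
            by measurable
        qed
        have eq: "emeasure M (Pair y -` {p \<in> space (\<mu> \<Otimes>\<^sub>M M). norm (f (snd p) x - f (snd p) (fst p)) \<le> r})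
            = emeasure M {l \<in> space M. norm (f l x - f l y) \<le> r}" if "y \<in> space \<mu>" for y
          using that by (intro arg_cong[where f="emeasure M"]) (auto simp: space_pair_measure)
        show "(\<lambda>y. emeasure M {l \<in> space M. norm (f l x - f l y) \<le> r}) \<in> borel_measurable \<mu>"
          by (rule measurable_cong[THEN iffD1, OF eq meas])
      qed
      also have "\<dots> \<le> 2 ^ (n * CARD('k)) * ennreal (B * r ^ CARD('k))"
        using x \<open>0 < r\<close> by (intro mult_left_mono bound) auto
      also have "\<dots> = ennreal (2 ^ (n * CARD('k))) * ennreal (B * r ^ CARD('k))"
        by (simp add: ennreal_power[symmetric])
      also have "\<dots> = ennreal (2 ^ (n * CARD('k)) * (B * r ^ CARD('k)))"
        by (rule ennreal_mult'[symmetric]) simp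
      also have "2 ^ (n * CARD('k)) * (B * r ^ CARD('k)) = B * real CARD('k) ^ CARD('k)"
        by (simp add: r_def power_divide power_mult)
      finally show ?thesis .
    qed
    have "(\<integral>\<^sup>+ l. dyadic_energy (distr \<mu> borel (f l)) n \<partial>M)
        = (\<integral>\<^sup>+ l. \<integral>\<^sup>+ x. \<integral>\<^sup>+ y. dyadic_kernel n (f l y) (f l x) \<partial>\<mu> \<partial>\<mu> \<partial>M)"
      by (intro nn_integral_cong energy)
    also have "\<dots> = (\<integral>\<^sup>+ x. \<integral>\<^sup>+ l. \<integral>\<^sup>+ y. dyadic_kernel n (f l y) (f l x) \<partial>\<mu> \<partial>M \<partial>\<mu>)"
    proof (rule M\<mu>.Fubini'[symmetric])
      show "(\<lambda>(l, x). \<integral>\<^sup>+ y. dyadic_kernel n (f l y) (f l x) \<partial>\<mu>) \<in> borel_measurable (M \<Otimes>\<^sub>M \<mu>)"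
        unfolding split_beta' by (intro \<mu>.borel_measurable_nn_integral) (simp add: split_beta')
    qed
    also have "\<dots> \<le> (\<integral>\<^sup>+ x. ennreal (B * real CARD('k) ^ CARD('k)) \<partial>\<mu>)"
      by (intro nn_integral_mono close)
    finally show ?thesis by simp
  qed
qed

lemma borel_measurable_completion_AE_cong:
  fixes f g :: "'a \<Rightarrow> 'b::topological_space"
  assumes g: "g \<in> borel_measurable M" and eq: "AE x in M. f x = g x"
  shows "f \<in> borel_measurable (completion M)"
proof (rule measurableI)
  fix A :: "'b set" assume A: "A \<in> sets borel"
  show "f -` A \<inter> space (completion M) \<in> sets (completion M)"
  proof (rule completion.in_sets_AE)
    show "g -` A \<inter> space M \<in> sets (completion M)"
      using measurable_sets[OF g A] by simp
    show "AE x in completion M. x \<in> g -` A \<inter> space M \<longleftrightarrow> x \<in> f -` A \<inter> space (completion M)"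
      using AE_completion[OF eq] by eventually_elim simp
  qed simp
qed simp

section \<open>Projections of Hausdorff measure\<close>

theorem theorem1p3:
  fixes X X' :: "'a::complete_space set"
    and M :: "'l measure"
    and \<pi> :: "'l \<Rightarrow> 'a \<Rightarrow> real ^ 'k"
    and \<alpha> C d C' :: real
  assumes "analytic_set X"
    and "prob_space M"
    and "(\<lambda>(l, x). \<pi> l x) \<in> borel_measurable (M \<Otimes>\<^sub>M restrict_space borel X)"
    and "\<And>l. l \<in> space M \<Longrightarrow> continuous_on X (\<pi> l)"
    and "\<alpha> > 0" and "C > 0"
    and "\<And>\<delta> x1 x2. \<lbrakk>0 < \<delta>; \<delta> < 1; x1 \<in> X; x2 \<in> X; x1 \<noteq> x2\<rbrakk> \<Longrightarrow>
      measure M {l \<in> space M. norm (\<pi> l x1 - \<pi> l x2) \<le> \<delta> * dist x1 x2 powr \<alpha>} \<le> C * \<delta> ^ CARD('k)"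
    and "hausdorff_dim X > ennreal (\<alpha> * real CARD('k))"
    and "compact X'" and "X' \<subseteq> X"
    and "hausdorff_dim X' = ennreal d" and "d > \<alpha> * real CARD('k)"
    and "hausdorff_outer d X' > 0"
    and "C' > 0"
    and "\<And>x \<delta>. \<lbrakk>x \<in> X; \<delta> > 0\<rbrakk> \<Longrightarrow> hausdorff_outer d (X' \<inter> ball x \<delta>) \<le> ennreal (C' * \<delta> powr d)"
  shows "(AE l in M. absolutely_continuous lborel (projected_measure d X' (\<pi> l))) \<and>
    (AE l in M. L2_norm_sq (RN_deriv lborel (projected_measure d X' (\<pi> l))) < \<infinity>) \<and>
    (\<lambda>l. L2_norm_sq (RN_deriv lborel (projected_measure d X' (\<pi> l))))
      \<in> borel_measurable (completion M) \<and>
    (\<integral>\<^sup>+ l. L2_norm_sq (RN_deriv lborel (projected_measure d X' (\<pi> l))) \<partial>completion M) < \<infinity>"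
proof -
  interpret M: prob_space M by fact
  note transversal = assms(7) and compact = \<open>compact X'\<close> and growth = assms(15)
  define s where "s = \<alpha> * real CARD('k)"
  define \<mu> where "\<mu> = restrict_space (hausdorff_measure d) X'"
  define \<nu> where "\<nu> l = projected_measure d X' (\<pi> l)" for l
  have \<nu>: "\<nu> l = distr \<mu> borel (\<pi> l)" for l
    by (simp add: \<nu>_def \<mu>_def projected_measure_def)
  have "0 < s" "s < d"
    using \<open>\<alpha> > 0\<close> \<open>d > \<alpha> * real CARD('k)\<close> by (auto simp: s_def)
  have X'_borel: "X' \<in> sets borel"
    using compact by (rule borel_compact)
  have space_\<mu> [simp]: "space \<mu> = X'"
    by (simp add: \<mu>_def space_restrict_space)
  have sets_\<mu> [measurable_cong]: "sets \<mu> = sets (restrict_space borel X')"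
    by (simp add: \<mu>_def sets_restrict_space)
  have emeasure_\<mu>: "emeasure \<mu> A = hausdorff_outer d A" if "A \<in> sets \<mu>" for A
  proof -
    have "A \<subseteq> X'" "A \<in> sets borel"
      using that X'_borel sets.sets_into_space[OF that] by (auto simp: sets_\<mu> sets_restrict_space_iff)
    then show ?thesis
      using X'_borel by (simp add: \<mu>_def emeasure_restrict_space emeasure_hausdorff_measure)
  qed
  have dist_meas [measurable]: "(\<lambda>y. dist x y) \<in> borel_measurable \<mu>" for x
    unfolding measurable_cong_sets[OF sets_\<mu> refl]
    by (intro borel_measurable_continuous_on_restrict continuous_intros)
  have ball: "emeasure \<mu> {y \<in> space \<mu>. dist x y < \<delta>} \<le> ennreal (C' * \<delta> powr d)"
    if "x \<in> X'" "0 < \<delta>" for x \<delta>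
  proof -
    have "{y \<in> space \<mu>. dist x y < \<delta>} = X' \<inter> ball x \<delta>" by auto
    moreover have "{y \<in> space \<mu>. dist x y < \<delta>} \<in> sets \<mu>" by measurable
    ultimately show ?thesis
      using growth[of x \<delta>] that \<open>X' \<subseteq> X\<close> by (auto simp: emeasure_\<mu>)
  qed
  \<comment> \<open>Transversality concerns distinct points only, so the diagonal must be negligible: \<open>\<mu>\<close> has no
    atoms, since \<open>\<mu> {x}\<close> is at most \<open>C' * \<delta> powr d\<close> for every positive \<open>\<delta>\<close>.\<close>
  have null: "AE y in \<mu>. x \<noteq> y" if x: "x \<in> X'" for x
  proof -
    have "{x} \<in> sets \<mu>"
      using x X'_borel by (simp add: sets_\<mu> sets_restrict_space_iff)
    have "((\<lambda>\<delta>. ennreal (C' * \<delta> powr d)) \<longlongrightarrow> ennreal (C' * 0 powr d)) (at_right 0)"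
      using \<open>0 < s\<close> \<open>s < d\<close>
      by (intro tendsto_intros) (auto simp: eventually_at_right_field intro!: exI[of _ 1])
    moreover have "\<forall>\<^sub>F \<delta> in at_right 0. emeasure \<mu> {x} \<le> ennreal (C' * \<delta> powr d)"
    proof -
      have "emeasure \<mu> {x} \<le> ennreal (C' * \<delta> powr d)" if "0 < \<delta>" for \<delta>
      proof -
        have "emeasure \<mu> {x} \<le> emeasure \<mu> {y \<in> space \<mu>. dist x y < \<delta>}"
        proof (rule emeasure_mono)
          show "{y \<in> space \<mu>. dist x y < \<delta>} \<in> sets \<mu>" by measurable
        qed (use x that in simp)
        also note ball[OF x that]
        finally show ?thesis .
      qed
      then show ?thesis
        by (auto simp: eventually_at_right_field intro!: exI[of _ 1])
    qed
    ultimately have "emeasure \<mu> {x} \<le> ennreal (C' * 0 powr d)"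
      by (rule tendsto_lowerbound) simp
    then have "{x} \<in> null_sets \<mu>"
      using \<open>{x} \<in> sets \<mu>\<close> by (auto simp: null_sets_def)
    then show ?thesis
      by (rule AE_not_in[THEN eventually_mono]) auto
  qed
  define R where "R = diameter X' + 1"
  have "0 < R"
    using diameter_ge_0[OF compact_imp_bounded[OF compact]] by (simp add: R_def)
  have dist_less_R: "dist x y < R" if "x \<in> X'" "y \<in> X'" for x y
    using diameter_bounded_bound[OF compact_imp_bounded[OF compact] that] by (simp add: R_def)
  have finite: "finite_measure \<mu>"
  proof (rule finite_measureI)
    obtain x where x: "x \<in> X'"
      using \<open>hausdorff_outer d X' > 0\<close> by fastforce
    have "{y \<in> space \<mu>. dist x y < R} = space \<mu>"
      using dist_less_R[OF x] by auto
    then show "emeasure \<mu> (space \<mu>) \<noteq> \<infinity>"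
      using ball[OF x \<open>0 < R\<close>] by (auto simp: top_unique)
  qed
  have \<pi>_meas: "(\<lambda>(l, x). \<pi> l x) \<in> borel_measurable (M \<Otimes>\<^sub>M \<mu>)"
  proof -
    have "(\<lambda>x. x) \<in> \<mu> \<rightarrow>\<^sub>M restrict_space borel X"
    proof (rule measurable_restrict_space2)
      have "(\<lambda>x. x) \<in> restrict_space borel X' \<rightarrow>\<^sub>M borel"
        by (rule measurable_restrict_space1) simp
      then show "(\<lambda>x. x) \<in> \<mu> \<rightarrow>\<^sub>M borel"
        by (simp cong: measurable_cong_sets add: sets_\<mu>)
    qed (use \<open>X' \<subseteq> X\<close> in auto)
    then have "(\<lambda>p. (fst p, snd p)) \<in> M \<Otimes>\<^sub>M \<mu> \<rightarrow>\<^sub>M M \<Otimes>\<^sub>M restrict_space borel X"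
      by (intro measurable_Pair measurable_fst measurable_compose[OF measurable_snd])
    from measurable_compose[OF this assms(3)] show ?thesis
      by (simp add: split_beta')
  qed
  define K where "K = C' * R powr (d - s) * 2 powr s / (1 - 2 powr (s - d))"
  have close: "(\<integral>\<^sup>+ y. emeasure M {l \<in> space M. norm (\<pi> l x - \<pi> l y) \<le> r} \<partial>\<mu>)
      \<le> ennreal (max C 1 * K * r ^ CARD('k))" if x: "x \<in> space \<mu>" and r: "0 < r" for x r
  proof -
    have "x \<in> X'" using x by simp
    have "(\<integral>\<^sup>+ y. emeasure M {l \<in> space M. norm (\<pi> l x - \<pi> l y) \<le> r} \<partial>\<mu>)
        \<le> (\<integral>\<^sup>+ y. ennreal (max C 1 * r ^ CARD('k)) * ennreal (dist x y powr - s) \<partial>\<mu>)"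
    proof (rule nn_integral_mono_AE)
      show "AE y in \<mu>. emeasure M {l \<in> space M. norm (\<pi> l x - \<pi> l y) \<le> r}
          \<le> ennreal (max C 1 * r ^ CARD('k)) * ennreal (dist x y powr - s)"
        using null[OF \<open>x \<in> X'\<close>] AE_space
      proof eventually_elim
        case (elim y)
        have "emeasure M {l \<in> space M. norm (\<pi> l x - \<pi> l y) \<le> r}
            \<le> ennreal (max C 1 * r ^ CARD('k) * dist x y powr - s)"
          unfolding s_def
        proof (rule emeasure_projection_close_le)
          show "measure M {l \<in> space M. norm (\<pi> l x - \<pi> l y) \<le> \<delta> * dist x y powr \<alpha>}
              \<le> C * \<delta> ^ CARD('k)" if "0 < \<delta>" "\<delta> < 1" for \<delta>
            using that elim \<open>x \<in> X'\<close> \<open>X' \<subseteq> X\<close> by (intro transversal) auto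
        qed (use elim r M.prob_space_axioms in auto)
        then show ?case
          by (simp add: ennreal_mult'')
      qed
    qed
    also have "\<dots> = ennreal (max C 1 * r ^ CARD('k)) * (\<integral>\<^sup>+ y. ennreal (dist x y powr - s) \<partial>\<mu>)"
      by (rule nn_integral_cmult) measurable
    also have "\<dots> \<le> ennreal (max C 1 * r ^ CARD('k)) * ennreal K"
      unfolding K_def
      using \<open>0 < R\<close> \<open>C' > 0\<close> \<open>0 < s\<close> \<open>s < d\<close> dist_less_R[OF \<open>x \<in> X'\<close>]
      by (intro mult_left_mono nn_integral_dist_powr_le dist_meas ball[OF \<open>x \<in> X'\<close>]) simp_all
    also have "\<dots> = ennreal (max C 1 * K * r ^ CARD('k))"
      using r by (subst ennreal_mult'[symmetric]) (auto simp: mult_ac)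
    finally show ?thesis .
  qed
  define L where "L = ennreal (max C 1 * K * real CARD('k) ^ CARD('k)) * emeasure \<mu> (space \<mu>)"
  have "L < \<infinity>"
    using finite_measure.emeasure_finite[OF finite, of "space \<mu>"]
    by (simp add: L_def ennreal_mult_less_top less_top)
  define \<E> where "\<E> l = (SUP n. dyadic_energy (\<nu> l) n)" for l
  have meas [measurable]: "(\<lambda>l. dyadic_energy (\<nu> l) n) \<in> borel_measurable M" for n
    unfolding \<nu> by (rule borel_measurable_dyadic_energy_distr[OF finite M.prob_space_axioms \<pi>_meas])
  have \<E>_meas [measurable]: "\<E> \<in> borel_measurable M"
    unfolding \<E>_def by measurable
  have vec: "finite_borel_measure_vec (\<nu> l)" if "l \<in> space M" for l
  proof -
    have "\<pi> l \<in> borel_measurable \<mu>"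
      using measurable_compose[OF measurable_Pair1'[OF that] \<pi>_meas] by simp
    then show ?thesis
      using finite_measure.finite_measure_distr[OF finite]
      by (simp add: \<nu> finite_borel_measure_vec_def finite_borel_measure_vec_axioms_def)
  qed
  have int_\<E>: "(\<integral>\<^sup>+ l. \<E> l \<partial>M) \<le> L"
  proof -
    have "(\<integral>\<^sup>+ l. \<E> l \<partial>M) = (SUP n. \<integral>\<^sup>+ l. dyadic_energy (\<nu> l) n \<partial>M)"
      unfolding \<E>_def
    proof (rule nn_integral_monotone_convergence_SUP_AE)
      show "AE l in M. dyadic_energy (\<nu> l) n \<le> dyadic_energy (\<nu> l) (Suc n)" for n
        using finite_borel_measure_vec.incseq_dyadic_energy[OF vec]
        by (auto intro!: AE_I2 dest: incseq_SucD)
    qed measurable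
    also have "\<dots> \<le> L"
      unfolding L_def \<nu>
      by (intro SUP_least nn_integral_dyadic_energy_distr_le[OF finite M.prob_space_axioms \<pi>_meas close])
    finally show ?thesis .
  qed
  have "AE l in M. \<E> l \<noteq> \<infinity>"
    using int_\<E> \<open>L < \<infinity>\<close> by (intro nn_integral_noteq_infinite) auto
  then have good: "AE l in M. absolutely_continuous lborel (\<nu> l) \<and>
      L2_norm_sq (RN_deriv lborel (\<nu> l)) = \<E> l \<and> \<E> l < \<infinity>"
    using AE_space
  proof eventually_elim
    case (elim l)
    interpret finite_borel_measure_vec "\<nu> l"
      using elim by (intro vec)
    have "\<E> l < \<infinity>"
      using elim by (simp add: less_top)
    then show ?case
      using absolutely_continuous_lborel L2_norm_sq_RN_deriv unfolding \<E>_def by blast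
  qed
  have eq: "AE l in M. L2_norm_sq (RN_deriv lborel (\<nu> l)) = \<E> l"
    using good by eventually_elim simp
  have "(\<integral>\<^sup>+ l. L2_norm_sq (RN_deriv lborel (\<nu> l)) \<partial>completion M) = (\<integral>\<^sup>+ l. \<E> l \<partial>M)"
    unfolding nn_integral_completion using eq by (rule nn_integral_cong_AE)
  also have "\<dots> < \<infinity>"
    using int_\<E> \<open>L < \<infinity>\<close> by (rule le_less_trans)
  finally have "(\<integral>\<^sup>+ l. L2_norm_sq (RN_deriv lborel (\<nu> l)) \<partial>completion M) < \<infinity>" .
  moreover have "AE l in M. absolutely_continuous lborel (\<nu> l)"
    using good by eventually_elim simp
  moreover have "AE l in M. L2_norm_sq (RN_deriv lborel (\<nu> l)) < \<infinity>"
    using good by eventually_elim simp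
  moreover have "(\<lambda>l. L2_norm_sq (RN_deriv lborel (\<nu> l))) \<in> borel_measurable (completion M)"
    using \<E>_meas eq by (rule borel_measurable_completion_AE_cong)
  ultimately show ?thesis
    unfolding \<nu>_def by blast
qed

end
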